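(* Let $M$ be a compact manifold of positive dimension and let $1\le r\le\infty$. For every sequence $(a_n)_{n\ge1}$ of positive integers, the property of displaying a fast growth of the number of periodic points, that is, $$\limsup_{n\to\infty}\frac{\mathrm{Card}\, \mathrm{Per}^0_n f}{a_n}=\infty ,$$ is a generically localizable property on $\mathrm{Diff}^r(M)$.
   Context: $\mathrm{Diff}^r(M)$ is the space of $C^r$-diffeomorphisms of $M$ endowed with its canonical $C^r$-topology. For $f\in\mathrm{Diff}^r(M)$ and $n\ge1$, $\mathrm{Per}_n f=\{x\in M: f^n(x)=x\}$, and $\mathrm{Per}^0_n f\subset\mathrm{Per}_n f$ is the subset of its isolated points; its cardinality may be infinite, in which case the quotient above is $\infty$. A property on $\mathrm{Diff}^r(M)$ is a predicate on its elements. That there is a $C^r$-perturbation $\tilde f$ of $f$ with a given feature means that every $C^r$-neighborhood of $f$ contains such an $\tilde f$. A property $(\mathscr P)$ on $\mathrm{Diff}^r(M)$ is localizable if for every non-empty open set $U\subset M$, every $N\ge 1$ and every $f\in\mathrm{Diff}^r(M)$ with $f^N|_U=\mathrm{id}|_U$, there exists a $C^r$-perturbation $\tilde f$ of $f$ which satisfies $(\mathscr P)$. It is openly localizable if moreover the perturbation $\tilde f$ can be chosen in a $C^r$-open set of diffeomorphisms all satisfying $(\mathscr P)$. It is generically localizable if there is a countable family $\{(\mathscr P_i): i\ge 0\}$ of openly localizable properties whose conjunction implies it: $\bigwedge_i(\mathscr P_i)\Rightarrow(\mathscr P)$. *)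

theory Defs
  imports "HOL-Analysis.Analysis" "HOL-Library.Extended_Nat"
begin

section \<open>Iterated directional derivatives and maps of class \<open>C\<^sup>k\<close>\<close>

primrec iter_deriv ::
    "'a list \<Rightarrow> ('a::real_normed_vector \<Rightarrow> 'b::real_normed_vector) \<Rightarrow> 'a \<Rightarrow> 'b" where
  "iter_deriv [] F = F"
| "iter_deriv (v # vs) F = (\<lambda>x. frechet_derivative (iter_deriv vs F) (at x) v)"

text \<open>Only used for open \<open>S\<close>; the exponent may be \<open>\<infinity>\<close>.\<close>

definition Cr_on ::
    "enat \<Rightarrow> 'a set \<Rightarrow> ('a::real_normed_vector \<Rightarrow> 'b::real_normed_vector) \<Rightarrow> bool" where
  "Cr_on r S F \<longleftrightarrow>
     (\<forall>vs. enat (length vs) \<le> r \<longrightarrow> continuous_on S (iter_deriv vs F)) \<and>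
     (\<forall>vs. enat (length vs) < r \<longrightarrow> (\<forall>x\<in>S. iter_deriv vs F differentiable at x))"


section \<open>Smooth manifolds\<close>

text \<open>A chart is a pair of its domain and its coordinate map; the latter is only meaningful on the
  domain.\<close>

type_synonym ('m, 'e) chart = "'m set \<times> ('m \<Rightarrow> 'e)"

definition chart_inv :: "('m, 'e) chart \<Rightarrow> 'e \<Rightarrow> 'm" where
  "chart_inv c = inv_into (fst c) (snd c)"

definition in_charts ::
    "('m, 'e) chart \<Rightarrow> ('n, 'd) chart \<Rightarrow> ('m \<Rightarrow> 'n) \<Rightarrow> 'e \<Rightarrow> 'd" where
  "in_charts c d f = snd d \<circ> f \<circ> chart_inv c"

text \<open>A manifold without boundary on the topological space \<open>X\<close>, with a smooth atlas \<open>A\<close>. Its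
  dimension is \<open>DIM('e)\<close>, which is positive for every type of class \<open>euclidean_space\<close>.\<close>

definition smooth_manifold ::
    "'m topology \<Rightarrow> ('m, 'e::euclidean_space) chart set \<Rightarrow> bool" where
  "smooth_manifold X A \<longleftrightarrow>
     Hausdorff_space X \<and> second_countable X \<and>
     (\<Union>c\<in>A. fst c) = topspace X \<and>
     (\<forall>c\<in>A. openin X (fst c) \<and> open (snd c ` fst c) \<and>
        homeomorphic_map (subtopology X (fst c)) (top_of_set (snd c ` fst c)) (snd c)) \<and>
     (\<forall>c\<in>A. \<forall>d\<in>A. Cr_on \<infinity> (snd c ` (fst c \<inter> fst d)) (in_charts c d id))"


section \<open>The space of \<open>C\<^sup>r\<close>-diffeomorphisms\<close>

definition Cr_map ::
    "enat \<Rightarrow> 'm topology \<Rightarrow> ('m, 'e::euclidean_space) chart set \<Rightarrow> ('m \<Rightarrow> 'm) \<Rightarrow> bool" where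
  "Cr_map r X A f \<longleftrightarrow> continuous_map X X f \<and>
     (\<forall>c\<in>A. \<forall>d\<in>A. Cr_on r (snd c ` {x \<in> fst c. f x \<in> fst d}) (in_charts c d f))"

text \<open>Extensionality makes the elements correspond one-to-one to the diffeomorphisms of
  \<open>topspace X\<close>.\<close>

definition Diff ::
    "enat \<Rightarrow> 'm topology \<Rightarrow> ('m, 'e::euclidean_space) chart set \<Rightarrow> ('m \<Rightarrow> 'm) set" where
  "Diff r X A = {f \<in> extensional (topspace X).
     bij_betw f (topspace X) (topspace X) \<and>
     Cr_map r X A f \<and> Cr_map r X A (inv_into (topspace X) f)}"

text \<open>The standard subbasic neighbourhoods of the (weak) \<open>C\<^sup>r\<close>-topology: in the charts \<open>c\<close> and \<open>d\<close>,
  all partial derivatives of order at most \<open>k\<close> are \<open>\<epsilon>\<close>-close on the compact set \<open>K\<close>.\<close>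

definition Cr_nbhd ::
    "enat \<Rightarrow> 'm topology \<Rightarrow> ('m, 'e::euclidean_space) chart set \<Rightarrow> ('m \<Rightarrow> 'm) \<Rightarrow>
     ('m, 'e) chart \<Rightarrow> ('m, 'e) chart \<Rightarrow> 'm set \<Rightarrow> nat \<Rightarrow> real \<Rightarrow> ('m \<Rightarrow> 'm) set" where
  "Cr_nbhd r X A f c d K k \<epsilon> = {g \<in> Diff r X A. g ` K \<subseteq> fst d \<and>
     (\<forall>x\<in>snd c ` K. \<forall>vs. set vs \<subseteq> Basis \<and> length vs \<le> k \<longrightarrow>
        norm (iter_deriv vs (in_charts c d g) x - iter_deriv vs (in_charts c d f) x) < \<epsilon>)}"

text \<open>For \<open>r = \<infinity>\<close> the orders \<open>k\<close> range over all natural numbers. The whole space is added to the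
  subbase only for the case of an empty atlas.\<close>

definition Cr_topology ::
    "enat \<Rightarrow> 'm topology \<Rightarrow> ('m, 'e::euclidean_space) chart set \<Rightarrow> ('m \<Rightarrow> 'm) topology" where
  "Cr_topology r X A = topology_generated_by (insert (Diff r X A)
     {Cr_nbhd r X A f c d K k \<epsilon> | f c d K k \<epsilon>.
        f \<in> Diff r X A \<and> c \<in> A \<and> d \<in> A \<and> compactin X K \<and> K \<subseteq> fst c \<and> f ` K \<subseteq> fst d \<and>
        enat k \<le> r \<and> 0 < \<epsilon>})"

lemma topspace_Cr_topology: "topspace (Cr_topology r X A) = Diff r X A"
  by (auto simp: Cr_topology_def topology_generated_by_topspace Cr_nbhd_def)


section \<open>Localizable properties\<close>

definition has_perturbation ::
    "enat \<Rightarrow> 'm topology \<Rightarrow> ('m, 'e::euclidean_space) chart set \<Rightarrow> ('m \<Rightarrow> 'm) \<Rightarrow>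
     (('m \<Rightarrow> 'm) \<Rightarrow> bool) \<Rightarrow> bool" where
  "has_perturbation r X A f Q \<longleftrightarrow>
     (\<forall>W. openin (Cr_topology r X A) W \<and> f \<in> W \<longrightarrow> (\<exists>g\<in>W. Q g))"

definition localizable ::
    "enat \<Rightarrow> 'm topology \<Rightarrow> ('m, 'e::euclidean_space) chart set \<Rightarrow> (('m \<Rightarrow> 'm) \<Rightarrow> bool) \<Rightarrow> bool" where
  "localizable r X A P \<longleftrightarrow>
     (\<forall>U N f. openin X U \<and> U \<noteq> {} \<and> 1 \<le> N \<and> f \<in> Diff r X A \<and> (\<forall>x\<in>U. (f ^^ N) x = x) \<longrightarrow>
        has_perturbation r X A f P)"

definition openly_localizable ::
    "enat \<Rightarrow> 'm topology \<Rightarrow> ('m, 'e::euclidean_space) chart set \<Rightarrow> (('m \<Rightarrow> 'm) \<Rightarrow> bool) \<Rightarrow> bool" where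
  "openly_localizable r X A P \<longleftrightarrow>
     (\<forall>U N f. openin X U \<and> U \<noteq> {} \<and> 1 \<le> N \<and> f \<in> Diff r X A \<and> (\<forall>x\<in>U. (f ^^ N) x = x) \<longrightarrow>
        has_perturbation r X A f
          (\<lambda>g. \<exists>V. openin (Cr_topology r X A) V \<and> g \<in> V \<and> (\<forall>h\<in>V. P h)))"

lemma openly_localizable_imp_localizable:
  "openly_localizable r X A P \<Longrightarrow> localizable r X A P"
  unfolding openly_localizable_def localizable_def has_perturbation_def by meson

definition generically_localizable ::
    "enat \<Rightarrow> 'm topology \<Rightarrow> ('m, 'e::euclidean_space) chart set \<Rightarrow> (('m \<Rightarrow> 'm) \<Rightarrow> bool) \<Rightarrow> bool" where
  "generically_localizable r X A P \<longleftrightarrow>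
     (\<exists>Q :: nat \<Rightarrow> ('m \<Rightarrow> 'm) \<Rightarrow> bool.
        (\<forall>i. openly_localizable r X A (Q i)) \<and>
        (\<forall>f\<in>Diff r X A. (\<forall>i. Q i f) \<longrightarrow> P f))"


section \<open>Growth of the number of periodic points\<close>

definition Per :: "'m topology \<Rightarrow> nat \<Rightarrow> ('m \<Rightarrow> 'm) \<Rightarrow> 'm set" where
  "Per X n f = {x \<in> topspace X. (f ^^ n) x = x}"

definition Per0 :: "'m topology \<Rightarrow> nat \<Rightarrow> ('m \<Rightarrow> 'm) \<Rightarrow> 'm set" where
  "Per0 X n f = {x \<in> Per X n f. \<exists>U. openin X U \<and> U \<inter> Per X n f = {x}}"

definition ecard :: "'a set \<Rightarrow> ereal" where
  "ecard S = (if finite S then ereal (real (card S)) else \<infinity>)"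

text \<open>The value at \<open>n = 0\<close> does not affect the upper limit.\<close>

definition fast_growth :: "'m topology \<Rightarrow> (nat \<Rightarrow> nat) \<Rightarrow> ('m \<Rightarrow> 'm) \<Rightarrow> bool" where
  "fast_growth X a f \<longleftrightarrow> limsup (\<lambda>n. ecard (Per0 X n f) / ereal (real (a n))) = \<infinity>"

end

(* Precompose f with a small diffeomorphism, supported near a point q of minimal period p in the open set of
   periodic points, that fixes q and has derivative s * id there with s < 1. Then q becomes a contracting
   point of period p. By the contraction principle such a point persists and stays isolated, as a point of
   period p m for every m >= 1, for all C^1-close maps. The perturbed map is still periodic on a smaller open
   set disjoint from the support, so the step can be repeated as often as desired, and every robust point
   survives the later steps; with m fixed in advance this yields openly many isolated points of period N m.
   That the perturbations tend to f in the C^r-topology is obtained without estimates, from the joint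
   regularity of the family in (t, x) and compactness. The bump map x - t b(x) (x - a) has as derivative a
   multiple of the identity plus an operator of rank one, so the inverse of its derivative is explicit. *)

theory Submission
  imports Defs
begin

section \<open>Calculus of maps of class \<open>C\<^sup>r\<close>\<close>

text \<open>The hypothesis says only that \<open>f ^^ N\<close> is the identity on an open set.
  Minimal periods may vary there and orbits may revisit the set, so a local change of
  \<open>f\<close> could act several times along one period. Where the minimal period is maximal it
  is locally constant, and a smaller open set is disjoint from its first \<open>p - 1\<close>
  images; on it the \<open>p\<close>-th iterate of the perturbed map is exactly the inserted
  contraction. This \<open>p\<close> may change from step to step, but it always divides
  \<open>N\<close>, so that all points can be counted under the common periods \<open>N * m\<close>.
  A contraction is inserted because one ball then serves all powers of the return map: the fixed
  point in it is unique for every \<open>m\<close>, which gives isolation at period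
  \<open>p * m\<close> for a single neighbourhood of maps. The countable family cannot prescribe its
  periods, since each member must work for every \<open>N\<close>. It asks for some sufficiently
  large period; once \<open>N\<close> is given, the number of points demanded is a finite number
  known before perturbing.\<close>

lemma frechet_derivative_cong_open:
  assumes "open S" "x \<in> S" "\<And>y. y \<in> S \<Longrightarrow> F y = G y"
  shows "frechet_derivative F (at x) = frechet_derivative G (at x)"
proof -
  \<comment> \<open>Both maps have the same derivatives at \<open>x\<close>, possibly none. As
    \<open>frechet_derivative\<close> is a choice among them, the values agree even where
    differentiability fails.\<close>
  have "(F has_derivative D) (at x) \<longleftrightarrow> (G has_derivative D) (at x)" for D
    using has_derivative_transform_within_open[of F D x UNIV S G]
      has_derivative_transform_within_open[of G D x UNIV S F] assms by auto
  then show ?thesis by (simp add: frechet_derivative_def)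
qed

lemma iter_deriv_cong:
  assumes "open S" "\<And>y. y \<in> S \<Longrightarrow> F y = G y" "x \<in> S"
  shows "iter_deriv vs F x = iter_deriv vs G x"
  using assms(3)
proof (induction vs arbitrary: x)
  case Nil then show ?case by (simp add: assms)
next
  case (Cons v vs)
  then show ?case
    using frechet_derivative_cong_open[OF assms(1), of x "iter_deriv vs F" "iter_deriv vs G"] by simp
qed

text \<open>\<open>iter_deriv\<close> differentiates along the head of the list last, so peeling
  from the end exposes the innermost derivative. Induction on the order can then pass from
  \<open>F\<close> to its directional derivatives.\<close>

lemma iter_deriv_snoc:
  "iter_deriv (vs @ [v]) F = iter_deriv vs (\<lambda>x. frechet_derivative F (at x) v)"
  by (induction vs) auto

text \<open>Reduces \<open>r\<close>, which may be infinite, to finite orders, where induction is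
  available.\<close>

lemma Cr_on_enat_iff: "Cr_on r S F \<longleftrightarrow> (\<forall>k. enat k \<le> r \<longrightarrow> Cr_on (enat k) S F)"
proof
  assume "Cr_on r S F"
  then show "\<forall>k. enat k \<le> r \<longrightarrow> Cr_on (enat k) S F"
    unfolding Cr_on_def using order.trans order.strict_trans2 by blast
next
  assume *: "\<forall>k. enat k \<le> r \<longrightarrow> Cr_on (enat k) S F"
  show "Cr_on r S F"
    unfolding Cr_on_def
  proof (intro conjI allI impI ballI)
    fix vs :: "'a list" assume "enat (length vs) \<le> r"
    then show "continuous_on S (iter_deriv vs F)" using * unfolding Cr_on_def by blast
  next
    fix vs :: "'a list" and x assume "enat (length vs) < r" "x \<in> S"
    moreover from this have "enat (Suc (length vs)) \<le> r" by (simp add: Suc_ile_eq)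
    ultimately show "iter_deriv vs F differentiable at x"
      using * unfolding Cr_on_def by (metis enat_ord_simps(2) lessI)
  qed
qed

lemmas Cr_on_enatI = Cr_on_enat_iff[THEN iffD2, rule_format]
lemmas Cr_on_enatD = Cr_on_enat_iff[THEN iffD1, rule_format]

lemma Cr_on_mono: "Cr_on r S F \<Longrightarrow> q \<le> r \<Longrightarrow> T \<subseteq> S \<Longrightarrow> Cr_on q T F"
  unfolding Cr_on_def by (meson continuous_on_subset order.strict_trans2 order.trans subsetD)

lemma Cr_on_0: "Cr_on (enat 0) S F \<longleftrightarrow> continuous_on S F"
  by (auto simp: Cr_on_def)

text \<open>Splitting off the innermost direction turns the definition into a recursion on the
  order, the basis of the inductive closure proofs below. Continuity of \<open>F\<close> itself
  follows from its differentiability.\<close>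

lemma Cr_on_Suc:
  "Cr_on (enat (Suc k)) S F \<longleftrightarrow>
     (\<forall>x\<in>S. F differentiable at x) \<and> (\<forall>v. Cr_on (enat k) S (\<lambda>x. frechet_derivative F (at x) v))"
  (is "?L \<longleftrightarrow> ?R")
proof
  assume L: ?L
  have "continuous_on S (iter_deriv (vs @ [v]) F)" if "length vs \<le> k" for vs v
    using L that unfolding Cr_on_def by (metis Suc_le_mono enat_ord_simps(1) length_append_singleton)
  moreover have "iter_deriv (vs @ [v]) F differentiable at x" if "length vs < k" "x \<in> S" for vs v x
    using L that unfolding Cr_on_def
    by (metis Suc_less_eq enat_ord_simps(2) length_append_singleton)
  moreover have "\<forall>x\<in>S. F differentiable at x"
    using L unfolding Cr_on_def by (metis enat_ord_simps(2) iter_deriv.simps(1) list.size(3) zero_less_Suc)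
  ultimately show ?R by (auto simp: Cr_on_def iter_deriv_snoc)
next
  assume R: ?R
  have cF: "continuous_on S F"
    using R by (meson continuous_at_imp_continuous_on differentiable_imp_continuous_within)
  have "continuous_on S (iter_deriv vs F)" if "length vs \<le> Suc k" for vs
  proof (cases vs rule: rev_cases)
    case (snoc ws v) then show ?thesis using R that by (auto simp: Cr_on_def iter_deriv_snoc)
  qed (use cF in auto)
  moreover have "iter_deriv vs F differentiable at x" if "length vs < Suc k" "x \<in> S" for vs x
  proof (cases vs rule: rev_cases)
    case (snoc ws v) then show ?thesis using R that by (auto simp: Cr_on_def iter_deriv_snoc)
  qed (use R that in auto)
  ultimately show ?L by (auto simp: Cr_on_def)
qed

text \<open>Continuity and differentiability are checked point by point, and
  \<open>iter_deriv\<close> depends only on the values near the point. This glues coordinate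
  expressions that are available only locally.\<close>

lemma Cr_on_local:
  assumes "\<And>x. x \<in> S \<Longrightarrow> \<exists>T G. open T \<and> x \<in> T \<and> Cr_on r T G \<and> (\<forall>y\<in>T. F y = G y)"
  shows "Cr_on r S F"
proof -
  have "isCont (iter_deriv vs F) x \<and> (enat (length vs) < r \<longrightarrow> iter_deriv vs F differentiable at x)"
    if "x \<in> S" "enat (length vs) \<le> r" for x vs
  proof -
    obtain T G where T: "open T" "x \<in> T" "Cr_on r T G" "\<forall>y\<in>T. F y = G y"
      using assms[OF \<open>x \<in> S\<close>] by blast
    have eq: "iter_deriv vs F y = iter_deriv vs G y" if "y \<in> T" for y
      using iter_deriv_cong[of T F G y vs] T that by auto
    have "continuous_on T (iter_deriv vs G)" using T(3) that(2) by (auto simp: Cr_on_def)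
    then have "continuous_on T (iter_deriv vs F)" using eq by (simp cong: continuous_on_cong)
    then have "isCont (iter_deriv vs F) x" using T continuous_on_eq_continuous_at by blast
    moreover have "iter_deriv vs F differentiable at x" if "enat (length vs) < r"
    proof -
      have "iter_deriv vs G differentiable at x" using T that by (auto simp: Cr_on_def)
      then show ?thesis using eq T
        by (metis differentiable_def has_derivative_transform_within_open)
    qed
    ultimately show ?thesis by blast
  qed
  then show ?thesis unfolding Cr_on_def
    by (meson continuous_at_imp_continuous_on order_less_imp_le)
qed

lemma Cr_on_cong:
  assumes "Cr_on r S G" "open S" "\<And>x. x \<in> S \<Longrightarrow> F x = G x"
  shows "Cr_on r S F"
  by (rule Cr_on_local) (use assms in blast)

text \<open>An explicit derivative \<open>F'\<close> replaces the choice operator of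
  \<open>Cr_on_Suc\<close>; since \<open>S\<close> is open the two agree near each point, hence also
  in all further derivatives.\<close>

lemma Cr_on_SucI:
  assumes "\<And>x. x \<in> S \<Longrightarrow> (F has_derivative F' x) (at x)"
    and "\<And>v. Cr_on (enat k) S (\<lambda>x. F' x v)" and "open S"
  shows "Cr_on (enat (Suc k)) S F"
  unfolding Cr_on_Suc
proof (intro conjI ballI allI)
  fix x assume "x \<in> S" then show "F differentiable at x" using assms(1) differentiable_def by blast
next
  fix v
  have "F' x = frechet_derivative F (at x)" if "x \<in> S" for x
    using assms(1)[OF that] by (rule frechet_derivative_at)
  then show "Cr_on (enat k) S (\<lambda>x. frechet_derivative F (at x) v)"
    by (intro Cr_on_cong[OF assms(2)[of v] assms(3)]) simp
qed

lemma Cr_on_has_derivative: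
  assumes "Cr_on r S F" "1 \<le> r" "x \<in> S"
  shows "(F has_derivative frechet_derivative F (at x)) (at x)"
proof -
  have "0 < r" using assms(2) by (metis less_le_trans zero_less_one)
  then have "iter_deriv [] F differentiable at x"
    using assms unfolding Cr_on_def by (metis list.size(3) zero_enat_def)
  then show ?thesis by (simp add: frechet_derivative_works)
qed

lemma Cr_on_continuous: "Cr_on r S F \<Longrightarrow> continuous_on S F"
  by (metis Cr_on_def iter_deriv.simps(1) list.size(3) zero_enat_def zero_le)

lemma Cr_on_iter_deriv_continuous:
  "Cr_on r S F \<Longrightarrow> enat (length vs) \<le> r \<Longrightarrow> continuous_on S (iter_deriv vs F)"
  by (simp add: Cr_on_def)

lemma Cr_on_Suc_derivative:
  "Cr_on (enat (Suc k)) S F \<Longrightarrow> x \<in> S \<Longrightarrow> (F has_derivative frechet_derivative F (at x)) (at x)"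
  by (simp add: Cr_on_Suc frechet_derivative_works)

section \<open>Closure under algebraic operations, composition and inversion\<close>

lemma Cr_on_const: "Cr_on r S (\<lambda>x. c)"
proof -
  have "Cr_on (enat k) UNIV (\<lambda>x. c)" for k
  proof (induction k arbitrary: c)
    case 0 show ?case by (simp add: Cr_on_0)
  next
    case (Suc k) show ?case
      by (rule Cr_on_SucI[OF has_derivative_const]) (auto intro: Suc)
  qed
  then have "Cr_on (enat k) S (\<lambda>x. c)" for k by (rule Cr_on_mono) auto
  then show ?thesis by (auto intro: Cr_on_enatI)
qed

lemma Cr_on_bounded_linear:
  assumes "bounded_linear L" shows "Cr_on r S L"
proof -
  have "Cr_on (enat k) UNIV L" for k
  proof (cases k)
    case 0 then show ?thesis using assms by (simp add: Cr_on_0 linear_continuous_on)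
  next
    case (Suc k) 
    have "Cr_on (enat (Suc k)) UNIV L"
      by (rule Cr_on_SucI) (use bounded_linear_imp_has_derivative[OF assms] in \<open>auto intro: Cr_on_const\<close>)
    then show ?thesis using Suc by simp
  qed
  then have "Cr_on (enat k) S L" for k by (rule Cr_on_mono) auto
  then show ?thesis by (auto intro: Cr_on_enatI)
qed

lemma Cr_on_add:
  assumes "Cr_on r S F" "Cr_on r S G" "open S"
  shows "Cr_on r S (\<lambda>x. F x + G x)"
proof -
  have "Cr_on (enat k) S (\<lambda>x. F x + G x)" if "Cr_on (enat k) S F" "Cr_on (enat k) S G" for k
    using that
  proof (induction k arbitrary: F G)
    case 0 then show ?case by (auto simp: Cr_on_0 intro: continuous_intros)
  next
    case (Suc k)
    show ?case
      by (rule Cr_on_SucI[OF has_derivative_add[OF Cr_on_Suc_derivative[OF Suc.prems(1)]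
              Cr_on_Suc_derivative[OF Suc.prems(2)]]])
        (use Suc assms(3) in \<open>auto simp: Cr_on_Suc\<close>)
  qed
  then show ?thesis using assms by (auto intro: Cr_on_enatI dest: Cr_on_enatD)
qed

lemma Cr_on_sum:
  assumes "\<And>i. i \<in> I \<Longrightarrow> Cr_on r S (F i)" "open S"
  shows "Cr_on r S (\<lambda>x. \<Sum>i\<in>I. F i x)"
  using assms(1) by (induction I rule: infinite_finite_induct) (auto intro: Cr_on_add Cr_on_const assms(2))

text \<open>The Leibniz rule writes the derivative as a sum of two products of maps of class
  \<open>k\<close>, so an induction over all pairs of factors closes.\<close>

lemma Cr_on_bilinear:
  assumes "bounded_bilinear pr" "Cr_on r S F" "Cr_on r S G" "open S"
  shows "Cr_on r S (\<lambda>x. pr (F x) (G x))"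
proof -
  interpret bounded_bilinear pr by fact
  have "Cr_on (enat k) S (\<lambda>x. pr (F x) (G x))" if "Cr_on (enat k) S F" "Cr_on (enat k) S G" for k
    using that
  proof (induction k arbitrary: F G)
    case 0 then show ?case by (auto simp: Cr_on_0 intro: continuous_on)
  next
    case (Suc k)
    have FG: "Cr_on (enat k) S F" "Cr_on (enat k) S G"
      using Suc.prems by (auto elim: Cr_on_mono)
    show ?case
      by (rule Cr_on_SucI[OF FDERIV[OF Cr_on_Suc_derivative[OF Suc.prems(1)]
              Cr_on_Suc_derivative[OF Suc.prems(2)]]])
        (use Suc FG assms(4) in \<open>auto simp: Cr_on_Suc intro!: Cr_on_add\<close>)
  qed
  then show ?thesis using assms by (auto intro: Cr_on_enatI dest: Cr_on_enatD)
qed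

lemmas Cr_on_scaleR = Cr_on_bilinear[OF bounded_bilinear_scaleR]
lemmas Cr_on_mult = Cr_on_bilinear[OF bounded_bilinear_mult]
lemmas Cr_on_inner = Cr_on_bilinear[OF bounded_bilinear_inner]

lemma Cr_on_linear_comp:
  assumes "bounded_linear L" "Cr_on r S F" "open S"
  shows "Cr_on r S (\<lambda>x. L (F x))"
proof -
  have "Cr_on (enat k) S (\<lambda>x. L (F x))" if "Cr_on (enat k) S F" for k
    using that
  proof (induction k arbitrary: F)
    case 0 then show ?case
      by (auto simp: Cr_on_0 intro: bounded_linear.continuous_on[OF assms(1)])
  next
    case (Suc k)
    show ?case
      by (rule Cr_on_SucI[OF bounded_linear.has_derivative[OF assms(1) Cr_on_Suc_derivative[OF Suc.prems(1)]]])
        (use Suc assms(3) in \<open>auto simp: Cr_on_Suc\<close>)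
  qed
  then show ?thesis using assms by (auto intro: Cr_on_enatI dest: Cr_on_enatD)
qed

lemma Cr_on_minus: "Cr_on r S F \<Longrightarrow> open S \<Longrightarrow> Cr_on r S (\<lambda>x. - F x)"
  by (rule Cr_on_linear_comp[OF bounded_linear_minus[OF bounded_linear_ident]])

lemma Cr_on_diff:
  "Cr_on r S F \<Longrightarrow> Cr_on r S G \<Longrightarrow> open S \<Longrightarrow> Cr_on r S (\<lambda>x. F x - G x)"
  using Cr_on_add[of r S F "\<lambda>x. - G x"] Cr_on_minus[of r S G] by simp

lemma Cr_on_Pair:
  assumes "Cr_on r S F" "Cr_on r S G" "open S"
  shows "Cr_on r S (\<lambda>x. (F x, G x))"
proof -
  have "Cr_on r S (\<lambda>x. (F x, 0) + (0, G x))"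
    by (intro Cr_on_add Cr_on_linear_comp[where L="\<lambda>y. (y, 0)"] Cr_on_linear_comp[where L="\<lambda>y. (0, y)"] 
        assms bounded_linear_Pair bounded_linear_ident bounded_linear_zero)
  then show ?thesis by simp
qed

text \<open>In the chain rule the direction \<open>?G' x v\<close> moves with \<open>x\<close>, so
  the induction hypothesis does not apply to the derivative directly. Expanding the direction in the
  basis leaves scalar functions times derivatives of \<open>F\<close> in fixed directions, composed
  with \<open>G\<close>; hence the Euclidean intermediate space.\<close>

lemma Cr_on_comp:
  fixes G :: "'a::real_normed_vector \<Rightarrow> 'b::euclidean_space" and F :: "'b \<Rightarrow> 'c::real_normed_vector"
  assumes "Cr_on r T F" "Cr_on r S G" "open S" "open T" "G ` S \<subseteq> T"
  shows "Cr_on r S (\<lambda>x. F (G x))"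
proof -
  have "Cr_on (enat k) S (\<lambda>x. F (G x))" if "Cr_on (enat k) T F" "Cr_on (enat k) S G" for k
    using that
  proof (induction k arbitrary: F)
    case 0 then show ?case using assms(5)
      by (auto simp: Cr_on_0 image_subset_iff intro: continuous_on_compose2)
  next
    case (Suc k)
    let ?F' = "\<lambda>x. frechet_derivative F (at x)" and ?G' = "\<lambda>x. frechet_derivative G (at x)"
    have G: "Cr_on (enat k) S G" using Suc.prems by (auto elim: Cr_on_mono)
    show ?case
    proof (rule Cr_on_SucI)
      fix x assume x: "x \<in> S"
      then have "G x \<in> T" using assms by auto
      have D: "((\<lambda>x. F (G x)) has_derivative (\<lambda>v. ?F' (G x) (?G' x v))) (at x)"
        using has_derivative_compose[OF Cr_on_Suc_derivative[OF Suc.prems(2) x] Cr_on_Suc_derivative[OF Suc.prems(1) \<open>G x \<in> T\<close>]] .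
      have rep: "?F' (G x) w = (\<Sum>b\<in>Basis. (w \<bullet> b) *\<^sub>R ?F' (G x) b)" for w
      proof -
        have "linear (?F' (G x))"
          using Cr_on_Suc_derivative[OF Suc.prems(1) \<open>G x \<in> T\<close>] has_derivative_linear by blast
        then have "?F' (G x) (\<Sum>b\<in>Basis. (w \<bullet> b) *\<^sub>R b) = (\<Sum>b\<in>Basis. (w \<bullet> b) *\<^sub>R ?F' (G x) b)"
          by (simp add: linear_sum linear_scale)
        then show ?thesis by (simp add: euclidean_representation)
      qed
      have e: "(\<lambda>v. ?F' (G x) (?G' x v)) = (\<lambda>v. \<Sum>b\<in>Basis. (?G' x v \<bullet> b) *\<^sub>R ?F' (G x) b)"
        by (rule ext, rule rep)
      show "((\<lambda>x. F (G x)) has_derivative (\<lambda>v. \<Sum>b\<in>Basis. (?G' x v \<bullet> b) *\<^sub>R ?F' (G x) b)) (at x)"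
        using D unfolding e .
    next
      fix v
      show "Cr_on (enat k) S (\<lambda>x. \<Sum>b\<in>Basis. (?G' x v \<bullet> b) *\<^sub>R ?F' (G x) b)"
        using Suc.prems G
        by (intro Cr_on_sum Cr_on_scaleR Cr_on_inner Cr_on_const Suc.IH assms) (auto simp: Cr_on_Suc)
    qed (fact assms)
  qed
  then show ?thesis using assms by (auto intro: Cr_on_enatI dest: Cr_on_enatD)
qed

lemma Cr_on_inverse:
  fixes F :: "'a::real_normed_vector \<Rightarrow> real"
  assumes "Cr_on r S F" "open S" "\<And>x. x \<in> S \<Longrightarrow> F x \<noteq> 0"
  shows "Cr_on r S (\<lambda>x. inverse (F x))"
proof -
  have "Cr_on (enat k) S (\<lambda>x. inverse (F x))" if "Cr_on (enat k) S F" for k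
    using that
  proof (induction k)
    case 0 then show ?case using assms by (auto simp: Cr_on_0 intro: continuous_intros)
  next
    case (Suc k)
    have F: "Cr_on (enat k) S F" using Suc.prems by (auto elim: Cr_on_mono)
    show ?case
      by (rule Cr_on_SucI[OF Deriv.has_derivative_inverse[OF assms(3) Cr_on_Suc_derivative[OF Suc.prems(1)]]])
        (use Suc F in \<open>auto simp: Cr_on_Suc intro!: Cr_on_minus Cr_on_mult assms\<close>)
  qed
  then show ?thesis using assms by (auto intro: Cr_on_enatI dest: Cr_on_enatD)
qed

lemma Cr_on_frechet_derivative:
  assumes "Cr_on \<infinity> S F" shows "Cr_on \<infinity> S (\<lambda>x. frechet_derivative F (at x) v)"
proof (rule Cr_on_enatI)
  fix k
  have "Cr_on (enat (Suc k)) S F" using assms by (rule Cr_on_enatD) simp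
  then show "Cr_on (enat k) S (\<lambda>x. frechet_derivative F (at x) v)" by (simp add: Cr_on_Suc)
qed

text \<open>Bootstrapping: the derivative of \<open>G\<close> at \<open>y\<close> is
  \<open>M (G y)\<close>, so if \<open>G\<close> is of class \<open>k\<close> its derivative is too,
  and \<open>G\<close> is of class \<open>k + 1\<close>. With the inverse \<open>M\<close> of the
  derivative given explicitly, no regularity of operator inversion enters.\<close>

lemma Cr_on_inverse_function:
  fixes F :: "'a::euclidean_space \<Rightarrow> 'b::real_normed_vector"
  assumes "open S" "open T" "continuous_on T G" "G ` T \<subseteq> S" "\<And>y. y \<in> T \<Longrightarrow> F (G y) = y"
    and F: "\<And>x. x \<in> S \<Longrightarrow> (F has_derivative F' x) (at x)"
    and M: "\<And>x. x \<in> S \<Longrightarrow> bounded_linear (M x)" "\<And>x v. x \<in> S \<Longrightarrow> M x (F' x v) = v"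
    and C: "\<And>v. Cr_on r S (\<lambda>x. M x v)"
  shows "Cr_on r T G"
proof -
  have "Cr_on (enat k) T G" if "enat k \<le> r" for k
    using that
  proof (induction k)
    case 0 then show ?case using assms by (simp add: Cr_on_0)
  next
    case (Suc k)
    have k: "enat k \<le> r" using Suc.prems by (meson enat_ord_simps(1) le_SucI order.trans order_refl)
    have G: "Cr_on (enat k) T G" using Suc.IH[OF k] .
    show ?case
    proof (rule Cr_on_SucI)
      fix y assume y: "y \<in> T"
      then have Gy: "G y \<in> S" using assms by auto
      show "(G has_derivative M (G y)) (at y)"
        by (rule has_derivative_inverse_basic[where T = T and g = G and y = y and f = F, OF F[OF Gy] M(1)[OF Gy]])
          (use M(2)[OF Gy] assms y in \<open>auto simp: fun_eq_iff continuous_on_eq_continuous_at\<close>)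
    next
      fix v
      have "Cr_on (enat k) S (\<lambda>x. M x v)" using C k by (meson Cr_on_mono order_refl)
      then show "Cr_on (enat k) T (\<lambda>y. M (G y) v)"
        by (rule Cr_on_comp[where G = G]) (use G assms in auto)
    qed (fact assms)
  qed
  then show ?thesis by (auto intro: Cr_on_enatI)
qed

text \<open>Directional derivatives of the slices of a jointly \<open>C\<^sup>r\<close> family are derivatives of the family in
  directions \<open>(0, v)\<close>; this yields their continuity in the parameter.\<close>

lemma iter_deriv_slice:
  fixes G :: "'p::real_normed_vector \<times> 'a::real_normed_vector \<Rightarrow> 'b::real_normed_vector"
  assumes "Cr_on r S G" "open S" "enat (length vs) \<le> r" "(t, y) \<in> S"
  shows "iter_deriv vs (\<lambda>y. G (t, y)) y = iter_deriv (map (Pair 0) vs) G (t, y)"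
  using assms(3,4)
proof (induction vs arbitrary: y)
  case (Cons v vs)
  let ?H = "iter_deriv (map (Pair (0::'p)) vs) G"
  have le: "enat (length vs) < r" "enat (length vs) \<le> r"
    using Cons.prems(1) by (auto simp: Suc_ile_eq)
  let ?T = "{y. (t, y) \<in> S}"
  have "open ?T"
    using open_vimage[OF \<open>open S\<close>, of "Pair t"] by (simp add: vimage_def continuous_on_Pair)
  moreover have "y \<in> ?T" using Cons.prems by auto
  ultimately have "frechet_derivative (iter_deriv vs (\<lambda>y. G (t, y))) (at y)
      = frechet_derivative (\<lambda>y. ?H (t, y)) (at y)"
    by (rule frechet_derivative_cong_open) (use Cons.IH le in auto)
  moreover have "frechet_derivative (\<lambda>y. ?H (t, y)) (at y) = (\<lambda>v. frechet_derivative ?H (at (t, y)) (0, v))"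
  proof -
    have "?H differentiable at (t, y)"
      using assms(1) le(1) Cons.prems(2) by (auto simp: Cr_on_def)
    then have H: "(?H has_derivative frechet_derivative ?H (at (t, y))) (at (t, y))"
      by (simp add: frechet_derivative_works)
    have P: "(Pair t has_derivative (\<lambda>v. (0, v))) (at y)"
      by (auto intro!: derivative_eq_intros)
    show ?thesis
      using frechet_derivative_at[OF has_derivative_compose[OF P H]] by simp
  qed
  ultimately show ?case by simp
qed simp

lemma Cr_on_slice:
  fixes G :: "'p::euclidean_space \<times> 'a::euclidean_space \<Rightarrow> 'b::real_normed_vector"
  assumes "Cr_on r S G" "open S"
  shows "Cr_on r {y. (t, y) \<in> S} (\<lambda>y. G (t, y))"
proof -
  have o: "open {y. (t, y) \<in> S}"
    using open_vimage[OF \<open>open S\<close>, of "Pair t"] by (simp add: vimage_def continuous_on_Pair)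
  show ?thesis
    by (rule Cr_on_comp[where G = "\<lambda>y. (t, y)", OF assms(1) Cr_on_Pair[OF Cr_on_const Cr_on_bounded_linear[OF bounded_linear_ident]]])
      (use o assms in auto)
qed

section \<open>Compactly supported contractions\<close>

text \<open>The exponent \<open>m\<close> makes the family closed under differentiation up to linear
  combinations, so the smoothness of the classical case \<open>m = 0\<close> is one induction over
  all \<open>m\<close> simultaneously.\<close>

definition flat :: "nat \<Rightarrow> real \<Rightarrow> real" where
  "flat m s = (if 0 < s then exp (- inverse s) / s ^ m else 0)"

text \<open>On the right, with \<open>u = 1/s\<close>, this is the decay of
  \<open>u^m / exp u\<close>.\<close>

lemma flat_tendsto_0: "(flat m \<longlongrightarrow> 0) (at 0)"
  unfolding filterlim_at_split
proof
  have "\<forall>\<^sub>F s in at_left 0. 0 = flat m s"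
    by (auto simp: flat_def eventually_at_left_field intro!: exI[of _ "-1"])
  then show "(flat m \<longlongrightarrow> 0) (at_left 0)" by (rule Lim_transform_eventually[OF tendsto_const])
next
  have "\<forall>\<^sub>F s in at_right 0. inverse s ^ m / exp (inverse s) = flat m s"
    by (auto simp: flat_def eventually_at_right_field exp_minus field_simps intro!: exI[of _ 1])
  then show "(flat m \<longlongrightarrow> 0) (at_right 0)"
    by (rule Lim_transform_eventually[rotated])
      (rule filterlim_compose[OF tendsto_power_div_exp_0 filterlim_inverse_at_top_right])
qed

lemma flat_has_derivative:
  "(flat m has_field_derivative (flat (m + 2) s - m * flat (m + 1) s)) (at s)"
proof -
  consider "s < 0" | "s = 0" | "0 < s" by linarith
  then show ?thesis
  proof cases
    case 1
    then have "(flat m has_field_derivative 0) (at s)"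
      by (intro DERIV_const[THEN has_field_derivative_transform_within_open, of "{..<0}"])
        (auto simp: flat_def)
    then show ?thesis using 1 by (simp add: flat_def)
  next
    case 2
    \<comment> \<open>The difference quotient at \<open>0\<close> belongs to the family again, so
      its limit is already known.\<close>
    have "(\<lambda>h. (flat m (0 + h) - flat m 0) / h) = flat (Suc m)"
      by (auto simp: flat_def fun_eq_iff field_simps)
    then have "(flat m has_field_derivative 0) (at 0)"
      using flat_tendsto_0[of "Suc m"] by (simp add: DERIV_def)
    then show ?thesis using 2 by (simp add: flat_def)
  next
    case 3
    have "real m * s ^ (m - Suc 0) = real m * s ^ m / s" using 3 by (cases m) auto
    then have "((\<lambda>s. exp (- inverse s) / s ^ m) has_field_derivative
        (flat (m + 2) s - m * flat (m + 1) s)) (at s)"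
      using 3 by (auto intro!: derivative_eq_intros simp: flat_def field_simps power2_eq_square)
    then show ?thesis
      by (rule has_field_derivative_transform_within_open[of _ _ _ "{0<..}"]) (use 3 in \<open>auto simp: flat_def\<close>)
  qed
qed

lemma Cr_on_flat: "Cr_on r UNIV (flat m)"
proof (rule Cr_on_enatI)
  fix k show "Cr_on (enat k) UNIV (flat m)"
  proof (induction k arbitrary: m)
    case 0
    show ?case using flat_has_derivative
      by (auto simp: Cr_on_0 continuous_on_eq_continuous_at intro!: DERIV_isCont)
  next
    case (Suc k)
    show ?case
      by (rule Cr_on_SucI[OF flat_has_derivative[unfolded has_field_derivative_def]])
        (auto intro!: Cr_on_mult Cr_on_diff Cr_on_const Suc)
  qed
qed

text \<open>\<open>flat 0\<close> is composed with a polynomial in the squared distance, which is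
  smooth even at \<open>a\<close>. Values stay below \<open>1\<close> because
  \<open>exp (- inverse s) < 1\<close> for positive \<open>s\<close>.\<close>

lemma smooth_bump:
  fixes a :: "'e::euclidean_space"
  assumes "0 < \<rho>"
  obtains \<beta> :: "'e \<Rightarrow> real" where "Cr_on \<infinity> UNIV \<beta>" "\<And>x. 0 \<le> \<beta> x" "\<And>x. \<beta> x < 1" "0 < \<beta> a"
    "\<And>x. \<rho> \<le> dist a x \<Longrightarrow> \<beta> x = 0"
proof
  let ?\<beta> = "\<lambda>x. flat 0 (\<rho>\<^sup>2 - (x - a) \<bullet> (x - a))"
  have "Cr_on \<infinity> UNIV (\<lambda>x. \<rho>\<^sup>2 - (x - a) \<bullet> (x - a))"
    by (intro Cr_on_diff Cr_on_inner Cr_on_const Cr_on_bounded_linear[OF bounded_linear_ident]) auto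
  then show "Cr_on \<infinity> UNIV ?\<beta>"
    by (rule Cr_on_comp[OF Cr_on_flat]) auto
  show "?\<beta> x = 0" if "\<rho> \<le> dist a x" for x
  proof -
    have "\<rho>\<^sup>2 \<le> (dist a x)\<^sup>2" using that assms by (intro power_mono) auto
    also have "\<dots> = (x - a) \<bullet> (x - a)" by (simp add: dist_norm norm_minus_commute[of a] power2_norm_eq_inner)
    finally show ?thesis by (simp add: flat_def)
  qed
qed (use assms in \<open>auto simp: flat_def\<close>)

section \<open>Derivative bounds and inversion near the identity\<close>

lemma norm_linear_le_Basis:
  fixes f :: "'a::euclidean_space \<Rightarrow> 'b::real_normed_vector" and C :: real
  assumes "linear f" "\<And>b. b \<in> Basis \<Longrightarrow> norm (f b) \<le> C"
  shows "norm (f v) \<le> DIM('a) * C * norm v"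
proof -
  have "norm (f v) = norm (f (\<Sum>b\<in>Basis. (v \<bullet> b) *\<^sub>R b))" by (simp add: euclidean_representation)
  also have "\<dots> = norm (\<Sum>b\<in>Basis. (v \<bullet> b) *\<^sub>R f b)"
    using assms(1) by (simp add: linear_sum linear_scale)
  also have "\<dots> \<le> (\<Sum>b\<in>(Basis::'a set). norm v * C)"
    by (intro sum_norm_le) (auto simp: assms Basis_le_norm intro!: mult_mono)
  finally show ?thesis by (simp add: mult_ac)
qed

text \<open>On the closed ball the bound comes from compactness; off it \<open>w\<close> vanishes on
  an open set, and its derivative with it.\<close>

lemma compact_support_derivative_bound:
  fixes w :: "'e::euclidean_space \<Rightarrow> 'f::real_normed_vector"
  assumes "Cr_on \<infinity> UNIV w" "\<And>x. \<rho> < dist a x \<Longrightarrow> w x = 0"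
  obtains C where "0 \<le> C" "\<And>x v. norm (frechet_derivative w (at x) v) \<le> C * norm v"
proof -
  let ?D = "\<lambda>x. frechet_derivative w (at x)"
  have "\<exists>B. \<forall>x\<in>cball a \<rho>. norm (?D x b) \<le> B" for b
  proof -
    have "continuous_on UNIV (\<lambda>x. ?D x b)"
      using Cr_on_frechet_derivative[OF assms(1)] by (rule Cr_on_continuous)
    then have "bounded ((\<lambda>x. ?D x b) ` cball a \<rho>)"
      by (intro compact_imp_bounded compact_continuous_image) (auto intro: continuous_on_subset)
    then show ?thesis by (auto simp: bounded_iff)
  qed
  then obtain B where B: "\<And>b x. x \<in> cball a \<rho> \<Longrightarrow> norm (?D x b) \<le> B b" by metis
  define C where "C = (\<Sum>b\<in>Basis. \<bar>B b\<bar>)"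
  have "norm (?D x b) \<le> C" if "b \<in> Basis" for x b
  proof (cases "x \<in> cball a \<rho>")
    case True
    then have "norm (?D x b) \<le> \<bar>B b\<bar>" using B[of x b] by linarith
    also have "\<dots> \<le> C" unfolding C_def by (rule member_le_sum) (use that in auto)
    finally show ?thesis .
  next
    case False
    then have "?D x = frechet_derivative (\<lambda>x. 0) (at x)"
      by (intro frechet_derivative_cong_open[where S = "- cball a \<rho>"]) (use assms(2) in auto)
    then show ?thesis by (simp add: C_def sum_nonneg)
  qed
  moreover have "linear (?D x)" for x
    using Cr_on_has_derivative[OF assms(1)] has_derivative_linear by (metis UNIV_I enat_ord_code(3))
  ultimately have "norm (?D x v) \<le> DIM('e) * C * norm v" for x v
    using norm_linear_le_Basis[of "?D x" C v] by blast
  moreover have "0 \<le> DIM('e) * C" by (simp add: C_def sum_nonneg)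
  ultimately show thesis using that by blast
qed

text \<open>Solving \<open>x - w x = y\<close> is a fixed point problem for the map sending
  \<open>x\<close> to \<open>y + w x\<close>, a contraction with constant one half. The same
  estimate makes the inverse 2-Lipschitz.\<close>

lemma perturbation_of_identity_bij:
  fixes w :: "'e::banach \<Rightarrow> 'e"
  assumes "\<And>x y. norm (w x - w y) \<le> norm (x - y) / 2"
  obtains \<psi> where "\<And>x. \<psi> (x - w x) = x" "\<And>y. \<psi> y - w (\<psi> y) = y" "continuous_on UNIV \<psi>"
proof -
  have lip: "norm (x - y) \<le> 2 * norm ((x - w x) - (y - w y))" for x y
  proof -
    have "x - y = ((x - w x) - (y - w y)) + (w x - w y)" by simp
    then have "norm (x - y) \<le> norm ((x - w x) - (y - w y)) + norm (w x - w y)"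
      by (metis norm_triangle_ineq)
    then show ?thesis using assms[of x y] by linarith
  qed
  have "\<exists>x. x - w x = y" for y
  proof -
    have "\<exists>!x. x \<in> UNIV \<and> y + w x = x"
      by (rule Banach_fix[of UNIV "1/2"]) (use assms in \<open>auto simp: dist_norm complete_UNIV\<close>)
    then obtain x where "y + w x = x" by blast
    then have "x - w x = y" by (metis add_diff_cancel_right')
    then show ?thesis by blast
  qed
  then obtain \<psi> where \<psi>: "\<And>y. \<psi> y - w (\<psi> y) = y" by metis
  have "\<psi> (x - w x) = x" for x using lip[of "\<psi> (x - w x)" x] \<psi>[of "x - w x"] by simp
  moreover have "continuous_on UNIV \<psi>"
  proof -
    have "dist (\<psi> x) (\<psi> y) \<le> 2 * dist x y" for x y
      using lip[of "\<psi> x" "\<psi> y"] by (simp add: \<psi> dist_norm)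
    then have "2-lipschitz_on UNIV \<psi>" by (intro lipschitz_onI) auto
    then show ?thesis by (rule lipschitz_on_continuous_on)
  qed
  ultimately show thesis using that \<psi> by blast
qed

lemma contraction_family:
  fixes a :: "'e::euclidean_space"
  assumes "0 < \<rho>"
  obtains \<Phi> :: "real \<times> 'e \<Rightarrow> 'e" and t\<^sub>0 where "0 < t\<^sub>0" "Cr_on \<infinity> UNIV \<Phi>" "\<And>x. \<Phi> (0, x) = x" "\<And>t. \<Phi> (t, a) = a"
    "\<And>t x. \<rho> \<le> dist a x \<Longrightarrow> \<Phi> (t, x) = x"
    "\<And>t. \<bar>t\<bar> < t\<^sub>0 \<Longrightarrow> \<exists>\<psi>. Cr_on \<infinity> UNIV \<psi> \<and> (\<forall>x. \<psi> (\<Phi> (t, x)) = x) \<and> (\<forall>x. \<Phi> (t, \<psi> x) = x)"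
    "\<And>t. 0 < t \<Longrightarrow> t < t\<^sub>0 \<Longrightarrow> \<exists>s. 0 \<le> s \<and> s < 1 \<and> ((\<lambda>x. \<Phi> (t, x)) has_derivative (\<lambda>v. s *\<^sub>R v)) (at a)"
proof -
  obtain \<beta> :: "'e \<Rightarrow> real" where \<beta>: "Cr_on \<infinity> UNIV \<beta>" "\<And>x. 0 \<le> \<beta> x" "\<And>x. \<beta> x < 1" "0 < \<beta> a"
    "\<And>x. \<rho> \<le> dist a x \<Longrightarrow> \<beta> x = 0"
    using smooth_bump[OF assms, of a] by metis
  define w where "w x = \<beta> x *\<^sub>R (x - a)" for x
  let ?\<Phi> = "\<lambda>p :: real \<times> 'e. snd p - fst p *\<^sub>R w (snd p)"
  have wC: "Cr_on \<infinity> UNIV w"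
    unfolding w_def
    by (intro Cr_on_diff Cr_on_scaleR \<beta> Cr_on_const Cr_on_bounded_linear[OF bounded_linear_ident]) auto
  have "Cr_on \<infinity> UNIV (\<lambda>p :: real \<times> 'e. w (snd p))"
    by (rule Cr_on_comp[OF wC Cr_on_bounded_linear[OF bounded_linear_snd]]) auto
  then have \<Phi>C: "Cr_on \<infinity> UNIV ?\<Phi>"
    by (intro Cr_on_diff Cr_on_scaleR Cr_on_bounded_linear[OF bounded_linear_snd]
        Cr_on_bounded_linear[OF bounded_linear_fst]) auto
  let ?l = "\<lambda>x. frechet_derivative \<beta> (at x)"
  define D where "D x v = \<beta> x *\<^sub>R v + ?l x v *\<^sub>R (x - a)" for x v
  have l: "(\<beta> has_derivative ?l x) (at x)" for x by (rule Cr_on_has_derivative[OF \<beta>(1)]) auto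
  have wD: "(w has_derivative D x) (at x)" for x
    unfolding w_def D_def
    by (rule has_derivative_eq_rhs[OF has_derivative_scaleR[OF l has_derivative_diff[OF has_derivative_ident has_derivative_const]]])
      auto
  have wD': "frechet_derivative w (at x) = D x" for x using frechet_derivative_at[OF wD] by simp
  obtain C where C: "0 \<le> C" "\<And>x v. norm (D x v) \<le> C * norm v"
    using compact_support_derivative_bound[OF wC, of \<rho> a] \<beta>(5) by (auto simp: w_def wD')
  \<comment> \<open>\<open>t\<^sub>0 * C \<le> 1/2\<close> gives the contraction needed for
    bijectivity, \<open>t\<^sub>0 * (C + 2) = 1/2\<close> keeps \<open>\<gamma>\<close> away from
    zero, and \<open>t\<^sub>0 < 1\<close> does the same for \<open>\<alpha>\<close> and makes the
    multiplier at \<open>a\<close> nonnegative.\<close>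
  define t\<^sub>0 where "t\<^sub>0 = 1 / (2 * (C + 2))"
  have t0: "0 < t\<^sub>0" "t\<^sub>0 * C \<le> 1/2" "t\<^sub>0 * (C + 2) = 1/2" "t\<^sub>0 < 1"
    using C(1) by (auto simp: t\<^sub>0_def field_simps)
  \<comment> \<open>\<open>D x\<close> multiplies the vector \<open>x - a\<close> by
    \<open>\<beta> x + ?l x (x - a)\<close>, so the bound on \<open>D\<close> controls this
    factor.\<close>
  have l_bound: "\<bar>?l x (x - a)\<bar> \<le> C + 1" for x
  proof (cases "x = a")
    case True
    then show ?thesis using has_derivative_linear[OF l[of x]] C by (simp add: linear_0)
  next
    case False
    have "\<bar>?l x (x - a)\<bar> * norm (x - a) = norm (D x (x - a) - \<beta> x *\<^sub>R (x - a))" by (simp add: D_def)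
    also have "\<dots> \<le> norm (D x (x - a)) + norm (\<beta> x *\<^sub>R (x - a))" by (rule norm_triangle_ineq4)
    also have "\<dots> \<le> C * norm (x - a) + 1 * norm (x - a)"
      using \<beta>(2,3)[of x] by (intro add_mono C) (auto intro!: mult_left_le_one_le)
    finally have "\<bar>?l x (x - a)\<bar> * norm (x - a) \<le> (C + 1) * norm (x - a)" by (simp add: algebra_simps)
    then show ?thesis using False by simp
  qed
  have inv: "\<exists>\<psi>. Cr_on \<infinity> UNIV \<psi> \<and> (\<forall>x. \<psi> (?\<Phi> (t, x)) = x) \<and> (\<forall>x. ?\<Phi> (t, \<psi> x) = x)" if t: "\<bar>t\<bar> < t\<^sub>0" for t
  proof -
    have wlip: "norm (w x - w y) \<le> C * norm (x - y)" for x y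
      by (rule differentiable_bound[where S = UNIV and f' = D])
        (use wD C in \<open>auto intro: onorm_bound\<close>)
    have "norm (t *\<^sub>R w x - t *\<^sub>R w y) \<le> norm (x - y) / 2" for x y
    proof -
      have "norm (t *\<^sub>R w x - t *\<^sub>R w y) = \<bar>t\<bar> * norm (w x - w y)"
        by (simp flip: scaleR_diff_right)
      also have "\<dots> \<le> t\<^sub>0 * (C * norm (x - y))" using t wlip[of x y] t0 by (intro mult_mono) auto
      also have "\<dots> \<le> 1/2 * norm (x - y)"
        using mult_right_mono[OF t0(2), of "norm (x - y)"] by (simp add: mult_ac)
      finally show ?thesis by simp
    qed
    from perturbation_of_identity_bij[OF this]
    obtain \<psi> where \<psi>: "\<And>x. \<psi> (x - t *\<^sub>R w x) = x" "\<And>y. \<psi> y - t *\<^sub>R w (\<psi> y) = y" "continuous_on UNIV \<psi>"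
      by metis
    \<comment> \<open>The derivative acts as \<open>\<alpha> x\<close> on the kernel of
      \<open>?l x\<close> and as \<open>\<gamma> x\<close> in the direction \<open>x - a\<close>. It
      is invertible when both are nonzero.\<close>
    define \<alpha> where "\<alpha> x = 1 - t * \<beta> x" for x
    define \<gamma> where "\<gamma> x = \<alpha> x - t * ?l x (x - a)" for x
    have \<alpha>: "\<alpha> x \<noteq> 0" for x
    proof -
      have "\<bar>t * \<beta> x\<bar> \<le> \<bar>t\<bar> * 1"
        unfolding abs_mult using \<beta>(2,3)[of x] by (intro mult_left_mono) auto
      then show ?thesis using t t0 by (auto simp: \<alpha>_def)
    qed
    have \<gamma>: "\<gamma> x \<noteq> 0" for x
    proof -
      have "\<bar>t * (\<beta> x + ?l x (x - a))\<bar> \<le> t\<^sub>0 * (C + 2)"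
        unfolding abs_mult using \<beta>(2,3)[of x] l_bound[of x] t by (intro mult_mono) auto
      then show ?thesis using t0 by (auto simp: \<gamma>_def \<alpha>_def algebra_simps)
    qed
    \<comment> \<open>The Sherman-Morrison formula for the inverse of \<open>\<alpha> x\<close>
      times the identity minus the rank one map that sends \<open>v\<close> to
      \<open>(t * ?l x v) *\<^sub>R (x - a)\<close>.\<close>
    define M where "M x v = inverse (\<alpha> x) *\<^sub>R v + (t * ?l x v * inverse (\<alpha> x) * inverse (\<gamma> x)) *\<^sub>R (x - a)" for x v
    have "Cr_on \<infinity> UNIV \<psi>"
    proof (rule Cr_on_inverse_function[where F = "\<lambda>x. x - t *\<^sub>R w x" and S = UNIV and F' = "\<lambda>x v. v - t *\<^sub>R D x v" and M = M])
      fix x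
      show "((\<lambda>x. x - t *\<^sub>R w x) has_derivative (\<lambda>v. v - t *\<^sub>R D x v)) (at x)"
        by (intro has_derivative_diff has_derivative_ident has_derivative_scaleR_right wD)
      have L: "bounded_linear (?l x)" using l by (rule has_derivative_bounded_linear)
      show "bounded_linear (M x)"
        unfolding M_def
        by (intro bounded_linear_add bounded_linear_const_scaleR bounded_linear_scaleR_const
            bounded_linear_mult_const bounded_linear_const_mult bounded_linear_ident L)
      fix v
      have lin: "linear (?l x)" using L by (rule bounded_linear.linear)
      have "v - t *\<^sub>R D x v = \<alpha> x *\<^sub>R v - (t * ?l x v) *\<^sub>R (x - a)"
        by (simp add: D_def \<alpha>_def algebra_simps)
      moreover have "?l x (\<alpha> x *\<^sub>R v - (t * ?l x v) *\<^sub>R (x - a)) = ?l x v * \<gamma> x"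
        using lin by (simp add: \<gamma>_def linear_diff linear_scale right_diff_distrib)
      ultimately have "M x (v - t *\<^sub>R D x v) = inverse (\<alpha> x) *\<^sub>R (\<alpha> x *\<^sub>R v - (t * ?l x v) *\<^sub>R (x - a))
          + (t * (?l x v * \<gamma> x) * inverse (\<alpha> x) * inverse (\<gamma> x)) *\<^sub>R (x - a)"
        by (simp only: M_def)
      also have "t * (?l x v * \<gamma> x) * inverse (\<alpha> x) * inverse (\<gamma> x) = inverse (\<alpha> x) * (t * ?l x v)"
        using \<gamma>[of x] by simp
      also have "inverse (\<alpha> x) *\<^sub>R (\<alpha> x *\<^sub>R v - (t * ?l x v) *\<^sub>R (x - a))
          = v - (inverse (\<alpha> x) * (t * ?l x v)) *\<^sub>R (x - a)"
        using \<alpha>[of x] by (simp only: scaleR_diff_right[of _ "\<alpha> x *\<^sub>R v"] scaleR_scaleR left_inverse scaleR_one simp_thms)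
      finally show "M x (v - t *\<^sub>R D x v) = v" by (simp only: diff_add_cancel)
    next
      fix v
      have \<alpha>C: "Cr_on \<infinity> UNIV \<alpha>" unfolding \<alpha>_def
        by (intro Cr_on_diff Cr_on_mult Cr_on_const \<beta>) auto
      \<comment> \<open>The direction \<open>x - a\<close> moves with \<open>x\<close>, so
        smoothness is obtained from the derivatives in the fixed basis directions.\<close>
      have "Cr_on \<infinity> UNIV (\<lambda>x. \<Sum>b\<in>Basis. ((x - a) \<bullet> b) *\<^sub>R ?l x b)"
        by (intro Cr_on_sum Cr_on_scaleR Cr_on_diff Cr_on_inner Cr_on_const
            Cr_on_bounded_linear[OF bounded_linear_ident] Cr_on_frechet_derivative \<beta>) auto
      moreover have "(\<Sum>b\<in>Basis. ((x - a) \<bullet> b) *\<^sub>R ?l x b) = ?l x (x - a)" for x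
      proof -
        have "?l x (\<Sum>b\<in>Basis. ((x - a) \<bullet> b) *\<^sub>R b) = (\<Sum>b\<in>Basis. ((x - a) \<bullet> b) *\<^sub>R ?l x b)"
          using has_derivative_linear[OF l[of x]] by (simp add: linear_sum linear_scale)
        then show ?thesis by (simp add: euclidean_representation)
      qed
      ultimately have "Cr_on \<infinity> UNIV (\<lambda>x. ?l x (x - a))" by simp
      then have \<gamma>C: "Cr_on \<infinity> UNIV \<gamma>" unfolding \<gamma>_def
        by (intro Cr_on_diff Cr_on_mult Cr_on_const \<alpha>C) auto
      show "Cr_on \<infinity> UNIV (\<lambda>x. M x v)"
        unfolding M_def
        by (intro Cr_on_add Cr_on_scaleR Cr_on_mult Cr_on_inverse Cr_on_const Cr_on_diff \<alpha>C \<gamma>C \<alpha> \<gamma>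
            Cr_on_frechet_derivative \<beta> Cr_on_bounded_linear[OF bounded_linear_ident]) auto
    qed (use \<psi> in auto)
    then show ?thesis using \<psi> by auto
  qed
  have der: "\<exists>s. 0 \<le> s \<and> s < 1 \<and> ((\<lambda>x. ?\<Phi> (t, x)) has_derivative (\<lambda>v. s *\<^sub>R v)) (at a)"
    if "0 < t" "t < t\<^sub>0" for t
  proof (intro exI conjI)
    have "((\<lambda>x. x - t *\<^sub>R w x) has_derivative (\<lambda>v. v - t *\<^sub>R D a v)) (at a)"
      by (intro has_derivative_diff has_derivative_ident has_derivative_scaleR_right wD)
    \<comment> \<open>At \<open>a\<close> the rank one term vanishes, which leaves the scalar
      \<open>s = 1 - t * \<beta> a\<close>.\<close>
    moreover have "(\<lambda>v. v - t *\<^sub>R D a v) = (\<lambda>v. (1 - t * \<beta> a) *\<^sub>R v)"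
      by (auto simp: D_def algebra_simps)
    ultimately show "((\<lambda>x. ?\<Phi> (t, x)) has_derivative (\<lambda>v. (1 - t * \<beta> a) *\<^sub>R v)) (at a)" by simp
    have "t * \<beta> a \<le> 1 * 1" using that t0 \<beta>(2,3)[of a] by (intro mult_mono) auto
    then show "0 \<le> 1 - t * \<beta> a" by simp
    show "1 - t * \<beta> a < 1" using that \<beta>(4) by simp
  qed
  show thesis
    by (rule that[OF t0(1) \<Phi>C _ _ _ inv der]) (auto simp: w_def \<beta>(5))
qed

section \<open>Perturbations supported in a chart\<close>

lemma in_charts_apply: "in_charts c d f y = snd d (f (chart_inv c y))"
  by (simp add: in_charts_def)

section \<open>Topology of charts and composition of maps\<close>

locale smooth_mfd =
  fixes X :: "'m topology" and A :: "('m, 'e::euclidean_space) chart set"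
  assumes mfd: "smooth_manifold X A"
begin

lemma Hausdorff: "Hausdorff_space X"
  using mfd by (simp add: smooth_manifold_def)

lemma chart_at: "x \<in> topspace X \<Longrightarrow> \<exists>c\<in>A. x \<in> fst c"
  using mfd unfolding smooth_manifold_def by blast

lemma Cr_on_transition: "c \<in> A \<Longrightarrow> d \<in> A \<Longrightarrow> Cr_on r (snd c ` (fst c \<inter> fst d)) (in_charts c d id)"
  using mfd unfolding smooth_manifold_def by (meson Cr_on_mono enat_ord_code(3) order_refl)

context
  fixes c assumes c: "c \<in> A"
begin

lemma chart_open: "openin X (fst c)" and chart_image_open: "open (snd c ` fst c)"
  and chart_homeo: "homeomorphic_map (subtopology X (fst c)) (top_of_set (snd c ` fst c)) (snd c)"
  using mfd c by (auto simp: smooth_manifold_def)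

lemma chart_topspace: "x \<in> fst c \<Longrightarrow> x \<in> topspace X"
  using openin_subset[OF chart_open] by blast

lemma topspace_chart: "topspace (subtopology X (fst c)) = fst c"
  using openin_subset[OF chart_open] by auto

lemma chart_inj: "inj_on (snd c) (fst c)"
  using homeomorphic_imp_injective_map[OF chart_homeo] by (simp add: topspace_chart del: topspace_subtopology)

lemma chart_inv_left: "x \<in> fst c \<Longrightarrow> chart_inv c (snd c x) = x"
  by (simp add: chart_inv_def chart_inj)

lemma chart_inv_right: "y \<in> snd c ` fst c \<Longrightarrow> snd c (chart_inv c y) = y"
  by (simp add: chart_inv_def f_inv_into_f)

lemma chart_inv_mem: "y \<in> snd c ` fst c \<Longrightarrow> chart_inv c y \<in> fst c"
  by (simp add: chart_inv_def inv_into_into)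

lemma open_chart_image:
  assumes "openin X V" shows "open (snd c ` (fst c \<inter> V))"
proof -
  have "openin (subtopology X (fst c)) (fst c \<inter> V)"
    using assms by (metis Int_commute openin_subtopology)
  then have "openin (top_of_set (snd c ` fst c)) (snd c ` (fst c \<inter> V))"
    using homeomorphic_imp_open_map[OF chart_homeo] unfolding open_map_def by blast
  then show ?thesis using chart_image_open openin_open_trans by blast
qed

lemma open_chart_preimage:
  assumes "open S" shows "openin X {x \<in> fst c. snd c x \<in> S}"
proof -
  have "openin (top_of_set (snd c ` fst c)) (snd c ` fst c \<inter> S)"
    using assms by (simp add: openin_open_Int)
  from openin_continuous_map_preimage[OF homeomorphic_imp_continuous_map[OF chart_homeo] this]
  have "openin (subtopology X (fst c)) {x \<in> fst c. snd c x \<in> snd c ` fst c \<inter> S}"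
    by (simp add: topspace_chart del: topspace_subtopology)
  moreover have "{x \<in> fst c. snd c x \<in> snd c ` fst c \<inter> S} = {x \<in> fst c. snd c x \<in> S}" by auto
  ultimately show ?thesis using chart_open openin_trans_full by metis
qed

lemma chart_inv_continuous: "continuous_map (top_of_set (snd c ` fst c)) X (chart_inv c)"
  unfolding continuous_map_def
proof (intro conjI allI impI)
  fix V assume V: "openin X V"
  have "{y \<in> topspace (top_of_set (snd c ` fst c)). chart_inv c y \<in> V} = snd c ` (fst c \<inter> V)"
    by (auto simp: chart_inv_left)
  then show "openin (top_of_set (snd c ` fst c)) {y \<in> topspace (top_of_set (snd c ` fst c)). chart_inv c y \<in> V}"
    using open_chart_image[OF V] by (metis image_mono inf_le1 open_subset)
qed (auto intro: chart_topspace chart_inv_mem)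

text \<open>Compactness passes through the continuous \<open>chart_inv c\<close>, and the Hausdorff
  property turns it into closedness in all of \<open>X\<close>. For the support of a perturbation
  this makes the complement open, so that the identity can be glued on there.\<close>

lemma closedin_chart_compact:
  assumes "compact K" "K \<subseteq> snd c ` fst c" shows "closedin X (chart_inv c ` K)"
proof -
  have "compactin (top_of_set (snd c ` fst c)) K" using assms by (simp add: compactin_subtopology)
  then have "compactin X (chart_inv c ` K)" using chart_inv_continuous image_compactin by blast
  then show ?thesis using Hausdorff compactin_imp_closedin by blast
qed

lemma compact_chart_image:
  assumes "compactin X K" "K \<subseteq> fst c" shows "compact (snd c ` K)"
proof -
  have "compactin (subtopology X (fst c)) K" using assms by (simp add: compactin_subtopology)
  then have "compactin (top_of_set (snd c ` fst c)) (snd c ` K)"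
    using homeomorphic_imp_continuous_map[OF chart_homeo] image_compactin by blast
  then show ?thesis by (simp add: compactin_subtopology)
qed

lemma open_chart_preimage_image:
  assumes "continuous_map X X f" "openin X V" shows "open (snd c ` {x \<in> fst c. f x \<in> V})"
proof -
  have "{x \<in> fst c. f x \<in> V} = fst c \<inter> {x \<in> topspace X. f x \<in> V}" using chart_topspace by blast
  then show ?thesis using open_chart_image[OF openin_continuous_map_preimage[OF assms]] by simp
qed

end

text \<open>\<open>inv_into\<close> agrees with a candidate inverse only on
  \<open>topspace X\<close>, so regularity has to be transferred from agreement there.\<close>

lemma Cr_map_cong:
  assumes "Cr_map r X A f" "\<And>x. x \<in> topspace X \<Longrightarrow> f x = g x"
  shows "Cr_map r X A g"
  unfolding Cr_map_def
proof (intro conjI ballI)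
  show "continuous_map X X g" using assms continuous_map_eq unfolding Cr_map_def by blast
  fix c d assume cd: "c \<in> A" "d \<in> A"
  have eq: "{x \<in> fst c. g x \<in> fst d} = {x \<in> fst c. f x \<in> fst d}"
    using assms(2) chart_topspace[OF cd(1)] by force
  show "Cr_on r (snd c ` {x \<in> fst c. g x \<in> fst d}) (in_charts c d g)"
    unfolding eq
  proof (rule Cr_on_cong)
    show "Cr_on r (snd c ` {x \<in> fst c. f x \<in> fst d}) (in_charts c d f)"
      using assms(1) cd by (auto simp: Cr_map_def)
    show "open (snd c ` {x \<in> fst c. f x \<in> fst d})"
      using assms(1) by (intro open_chart_preimage_image cd chart_open) (auto simp: Cr_map_def)
  qed (use assms(2) chart_topspace[OF cd(1)] in \<open>auto simp: in_charts_apply chart_inv_left[OF cd(1)]\<close>)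
qed

lemma Cr_map_id: "Cr_map r X A id"
  using Cr_on_transition by (auto simp: Cr_map_def Int_def)

text \<open>On a small open set the values of \<open>f\<close> stay in one chart \<open>e\<close>,
  and the coordinate expression factors through it.\<close>

lemma Cr_map_comp:
  assumes f: "Cr_map r X A f" and g: "Cr_map r X A g"
  shows "Cr_map r X A (g \<circ> f)"
  unfolding Cr_map_def
proof (intro conjI ballI)
  have cf: "continuous_map X X f" and cg: "continuous_map X X g" using f g by (auto simp: Cr_map_def)
  then show "continuous_map X X (g \<circ> f)" by (rule continuous_map_compose)
  fix c d assume c: "c \<in> A" and d: "d \<in> A"
  show "Cr_on r (snd c ` {x \<in> fst c. (g \<circ> f) x \<in> fst d}) (in_charts c d (g \<circ> f))"
  proof (rule Cr_on_local)
    fix y assume "y \<in> snd c ` {x \<in> fst c. (g \<circ> f) x \<in> fst d}"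
    then obtain x where x: "x \<in> fst c" "g (f x) \<in> fst d" "y = snd c x" by auto
    then have "f x \<in> topspace X"
      using cf chart_topspace[OF c] by (auto simp: continuous_map_def)
    then obtain e where e: "e \<in> A" "f x \<in> fst e" using chart_at by blast
    let ?W = "{z \<in> fst e. g z \<in> fst d}"
    let ?T = "snd c ` {x \<in> fst c. f x \<in> ?W}"
    have W: "openin X ?W"
    proof -
      have "?W = fst e \<inter> {x \<in> topspace X. g x \<in> fst d}" using chart_topspace[OF e(1)] by blast
      then show ?thesis
        using openin_continuous_map_preimage[OF cg chart_open[OF d]] chart_open[OF e(1)] by auto
    qed
    have oT: "open ?T" by (rule open_chart_preimage_image[OF c cf W])
    have "Cr_on r ?T (in_charts c e f)"
      by (rule Cr_on_mono[of r "snd c ` {x \<in> fst c. f x \<in> fst e}"])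
        (use f c e in \<open>auto simp: Cr_map_def\<close>)
    moreover have "Cr_on r (snd e ` ?W) (in_charts e d g)"
      using g e d by (auto simp: Cr_map_def)
    ultimately have "Cr_on r ?T (\<lambda>y. in_charts e d g (in_charts c e f y))"
      using oT open_chart_preimage_image[OF e(1) cg chart_open[OF d]]
      by (intro Cr_on_comp[where T = "snd e ` ?W" and F = "in_charts e d g" and G = "in_charts c e f"])
        (auto simp: in_charts_apply chart_inv_left[OF c])
    moreover have "\<forall>y\<in>?T. in_charts c d (g \<circ> f) y = in_charts e d g (in_charts c e f y)"
      by (auto simp: in_charts_apply chart_inv_left[OF c] chart_inv_left[OF e(1)])
    ultimately show "\<exists>T G. open T \<and> y \<in> T \<and> Cr_on r T G \<and> (\<forall>y\<in>T. in_charts c d (g \<circ> f) y = G y)"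
      using oT x e by blast
  qed
qed

end

text \<open>Extension by the identity: off its domain a coordinate map carries no meaning, hence the
  case distinction.\<close>

definition lift_chart :: "('m, 'e) chart \<Rightarrow> ('e \<Rightarrow> 'e) \<Rightarrow> 'm \<Rightarrow> 'm" where
  "lift_chart c \<phi> x = (if x \<in> fst c then chart_inv c (\<phi> (snd c x)) else x)"

text \<open>Regularity is required jointly in parameter and point. Invariance of the chart image is
  required only for parameters in \<open>I\<close>, where the family constructed later is injective.
  Single maps are covered as constant families.\<close>

locale chart_family = smooth_mfd X A for X :: "'m topology" and A :: "('m, 'e::euclidean_space) chart set" +
  fixes r :: enat and c\<^sub>0 :: "('m, 'e) chart" and a :: 'e and \<rho> :: real and \<Phi> :: "real \<times> 'e \<Rightarrow> 'e" and I :: "real set"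
  assumes c0: "c\<^sub>0 \<in> A" and cball: "cball a \<rho> \<subseteq> snd c\<^sub>0 ` fst c\<^sub>0" and I: "open I"
    and \<Phi>_Cr: "Cr_on r UNIV \<Phi>" and \<Phi>_supp: "\<And>t x. \<rho> < dist a x \<Longrightarrow> \<Phi> (t, x) = x"
    and \<Phi>_into: "\<And>t x. t \<in> I \<Longrightarrow> x \<in> snd c\<^sub>0 ` fst c\<^sub>0 \<Longrightarrow> \<Phi> (t, x) \<in> snd c\<^sub>0 ` fst c\<^sub>0"
begin

abbreviation "lift t \<equiv> lift_chart c\<^sub>0 (\<lambda>x. \<Phi> (t, x))"

lemma lift_in: "x \<in> fst c\<^sub>0 \<Longrightarrow> lift t x = chart_inv c\<^sub>0 (\<Phi> (t, snd c\<^sub>0 x))"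
  by (simp add: lift_chart_def)

lemma lift_outside: "x \<notin> chart_inv c\<^sub>0 ` cball a \<rho> \<Longrightarrow> lift t x = x"
  using chart_inv_left[OF c0, of x] \<Phi>_supp[of "snd c\<^sub>0 x" t]
  by (cases "snd c\<^sub>0 x \<in> cball a \<rho>") (force simp: lift_chart_def)+

context
  fixes F c
  assumes F: "Cr_map r X A F" and c: "c \<in> A"
begin

text \<open>For a chart domain \<open>V\<close> this is the set, in parameter and coordinates
  together, on which the coordinate expression of \<open>F\<close> after \<open>lift t\<close>
  exists.\<close>

definition \<Omega> where
  "\<Omega> V = {p. fst p \<in> I \<and> snd p \<in> snd c ` fst c \<and> F (lift (fst p) (chart_inv c (snd p))) \<in> V}"

text \<open>The domain of \<open>c\<^sub>0\<close> and the complement of the closed support cover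
  the manifold. On the first \<open>lift\<close> is read through \<open>\<Phi>\<close>, on the
  second it is the identity for every parameter. Openness and regularity of the family both follow
  from these two local descriptions.\<close>

lemma family_local:
  assumes "p \<in> \<Omega> V" and V: "openin X V"
  obtains
    T where "open T" "p \<in> T" "T \<subseteq> \<Omega> V" "T \<subseteq> UNIV \<times> snd c ` (fst c \<inter> fst c\<^sub>0)"
      "\<And>q. q \<in> T \<Longrightarrow> \<Phi> (fst q, in_charts c c\<^sub>0 id (snd q)) \<in> snd c\<^sub>0 ` {x \<in> fst c\<^sub>0. F x \<in> V}"
      "\<And>q. q \<in> T \<Longrightarrow> lift (fst q) (chart_inv c (snd q)) = chart_inv c\<^sub>0 (\<Phi> (fst q, in_charts c c\<^sub>0 id (snd q)))"
  | T where "open T" "p \<in> T" "T \<subseteq> \<Omega> V" "T \<subseteq> UNIV \<times> snd c ` {x \<in> fst c. F x \<in> V}"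
      "\<And>q. q \<in> T \<Longrightarrow> lift (fst q) (chart_inv c (snd q)) = chart_inv c (snd q)"
proof (cases "chart_inv c (snd p) \<in> fst c\<^sub>0")
  case True
  have cF: "continuous_map X X F" using F by (simp add: Cr_map_def)
  let ?S = "I \<times> snd c ` (fst c \<inter> fst c\<^sub>0)"
  let ?h = "\<lambda>q. \<Phi> (fst q, in_charts c c\<^sub>0 id (snd q))"
  let ?V = "snd c\<^sub>0 ` {x \<in> fst c\<^sub>0. F x \<in> V}"
  define T where "T = ?S \<inter> ?h -` ?V"
  have oS: "open ?S" by (intro open_Times I open_chart_image[OF c chart_open[OF c0]])
  have "continuous_on ?S (\<lambda>q. in_charts c c\<^sub>0 id (snd q))"
    by (rule continuous_on_compose2[OF Cr_on_continuous[OF Cr_on_transition[OF c c0]] continuous_on_snd[OF continuous_on_id]])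
      auto
  then have "continuous_on ?S ?h"
    by (intro continuous_on_compose2[OF Cr_on_continuous[OF \<Phi>_Cr]] continuous_on_Pair continuous_on_fst continuous_on_id) auto
  then have oT: "open T"
    unfolding T_def by (rule continuous_open_preimage[OF _ oS open_chart_preimage_image[OF c0 cF V]])
  have in0: "chart_inv c (snd q) \<in> fst c \<inter> fst c\<^sub>0" if "q \<in> ?S" for q
    using that by (auto simp: chart_inv_left[OF c])
  have lift_eq: "lift (fst q) (chart_inv c (snd q)) = chart_inv c\<^sub>0 (?h q)" if "q \<in> ?S" for q
    using in0[OF that] by (simp add: lift_in in_charts_apply)
  have pS: "p \<in> ?S" using assms(1) True chart_inv_mem[OF c] chart_inv_right[OF c]
    unfolding \<Omega>_def by (auto intro!: mem_Times_iff[THEN iffD2] image_eqI[of _ _ "chart_inv c (snd p)"])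
  have "?h p \<in> snd c\<^sub>0 ` fst c\<^sub>0"
    using assms(1) True by (auto simp: \<Omega>_def in_charts_apply intro!: \<Phi>_into)
  then have "?h p \<in> ?V"
    using assms(1) lift_eq[OF pS] chart_inv_mem[OF c0] chart_inv_right[OF c0]
    by (auto simp: \<Omega>_def intro!: image_eqI[of _ _ "chart_inv c\<^sub>0 (?h p)"])
  then have pT: "p \<in> T" using pS by (simp add: T_def)
  have TO: "T \<subseteq> \<Omega> V"
  proof
    fix q assume q: "q \<in> T"
    then have "F (chart_inv c\<^sub>0 (?h q)) \<in> V" by (auto simp: T_def chart_inv_left[OF c0])
    moreover have "q \<in> ?S" using q by (simp add: T_def)
    ultimately show "q \<in> \<Omega> V" using lift_eq by (auto simp: \<Omega>_def)
  qed
  show thesis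
    by (rule that(1)[OF oT pT TO]) (use lift_eq in \<open>auto simp: T_def\<close>)
next
  case False
  have cF: "continuous_map X X F" using F by (simp add: Cr_map_def)
  let ?V = "{x \<in> topspace X. F x \<in> V} - chart_inv c\<^sub>0 ` cball a \<rho>"
  let ?T = "I \<times> snd c ` (fst c \<inter> ?V)"
  have oV: "openin X ?V"
    by (intro openin_diff openin_continuous_map_preimage[OF cF V] closedin_chart_compact[OF c0 _ cball]) auto
  have oT: "open ?T" by (intro open_Times I open_chart_image[OF c oV])
  have lift_eq: "lift (fst q) (chart_inv c (snd q)) = chart_inv c (snd q)" if q: "q \<in> ?T" for q
  proof -
    obtain x where "x \<in> fst c" "x \<in> ?V" "snd q = snd c x" using q by (auto simp: mem_Times_iff)
    then show ?thesis by (simp add: chart_inv_left[OF c] lift_outside)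
  qed
  \<comment> \<open>The support lies inside the domain of \<open>c\<^sub>0\<close>, so a point
    outside the domain is outside the support.\<close>
  have out: "chart_inv c (snd p) \<notin> chart_inv c\<^sub>0 ` cball a \<rho>"
    using False subsetD[OF cball, THEN chart_inv_mem[OF c0]] by auto
  have p: "fst p \<in> I" "snd p \<in> snd c ` fst c" using assms(1) by (auto simp: \<Omega>_def)
  have "F (chart_inv c (snd p)) \<in> V" using assms(1) lift_outside[OF out] by (simp add: \<Omega>_def)
  then have "chart_inv c (snd p) \<in> fst c \<inter> ?V"
    using out chart_inv_mem[OF c p(2)] chart_topspace[OF c] by blast
  then have pT: "p \<in> ?T"
    using p chart_inv_right[OF c p(2)] by (auto simp: mem_Times_iff intro!: image_eqI[of _ _ "chart_inv c (snd p)"])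
  have TO: "?T \<subseteq> \<Omega> V"
  proof
    fix q assume q: "q \<in> ?T"
    then show "q \<in> \<Omega> V" using lift_eq[OF q] by (auto simp: \<Omega>_def chart_inv_left[OF c])
  qed
  show thesis by (rule that(2)[OF oT pT TO]) (use lift_eq in auto)
qed

lemma open_family:
  assumes "openin X V" shows "open (\<Omega> V)"
  unfolding open_subopen[of "\<Omega> V"]
proof
  fix p assume "p \<in> \<Omega> V"
  then show "\<exists>T. open T \<and> p \<in> T \<and> T \<subseteq> \<Omega> V" using assms by (rule family_local) iprover+
qed

lemma Cr_on_family:
  assumes d: "d \<in> A"
  shows "Cr_on r (\<Omega> (fst d)) (\<lambda>p. snd d (F (lift (fst p) (chart_inv c (snd p)))))"
proof (rule Cr_on_local)
  fix p assume p: "p \<in> \<Omega> (fst d)"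
  show "\<exists>T G. open T \<and> p \<in> T \<and> Cr_on r T G \<and> (\<forall>q\<in>T. snd d (F (lift (fst q) (chart_inv c (snd q)))) = G q)"
  proof (rule family_local[OF p chart_open[OF d]])
    fix T assume T: "open T" "p \<in> T" "T \<subseteq> UNIV \<times> snd c ` (fst c \<inter> fst c\<^sub>0)"
      "\<And>q. q \<in> T \<Longrightarrow> \<Phi> (fst q, in_charts c c\<^sub>0 id (snd q)) \<in> snd c\<^sub>0 ` {x \<in> fst c\<^sub>0. F x \<in> fst d}"
      "\<And>q. q \<in> T \<Longrightarrow> lift (fst q) (chart_inv c (snd q)) = chart_inv c\<^sub>0 (\<Phi> (fst q, in_charts c c\<^sub>0 id (snd q)))"
    have "Cr_on r T (\<lambda>q. in_charts c c\<^sub>0 id (snd q))"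
      by (rule Cr_on_comp[OF Cr_on_transition[OF c c0] Cr_on_bounded_linear[OF bounded_linear_snd] T(1)])
        (use T(3) open_chart_image[OF c chart_open[OF c0]] in auto)
    then have "Cr_on r T (\<lambda>q. \<Phi> (fst q, in_charts c c\<^sub>0 id (snd q)))"
      by (intro Cr_on_comp[OF \<Phi>_Cr] Cr_on_Pair Cr_on_bounded_linear[OF bounded_linear_fst] T) auto
    moreover have "Cr_on r (snd c\<^sub>0 ` {x \<in> fst c\<^sub>0. F x \<in> fst d}) (in_charts c\<^sub>0 d F)"
      using F c0 d by (simp add: Cr_map_def)
    moreover have "open (snd c\<^sub>0 ` {x \<in> fst c\<^sub>0. F x \<in> fst d})"
      using F by (intro open_chart_preimage_image c0 chart_open d) (simp add: Cr_map_def)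
    ultimately have "Cr_on r T (\<lambda>q. in_charts c\<^sub>0 d F (\<Phi> (fst q, in_charts c c\<^sub>0 id (snd q))))"
      using T by (intro Cr_on_comp[where F = "in_charts c\<^sub>0 d F" and G = "\<lambda>q. \<Phi> (fst q, in_charts c c\<^sub>0 id (snd q))"]) auto
    then show ?thesis using T by (intro exI[of _ T] exI conjI) (auto simp: in_charts_apply)
  next
    fix T assume T: "open T" "p \<in> T" "T \<subseteq> UNIV \<times> snd c ` {x \<in> fst c. F x \<in> fst d}"
      "\<And>q. q \<in> T \<Longrightarrow> lift (fst q) (chart_inv c (snd q)) = chart_inv c (snd q)"
    have "Cr_on r (snd c ` {x \<in> fst c. F x \<in> fst d}) (in_charts c d F)"
      using F c d by (simp add: Cr_map_def)
    moreover have "open (snd c ` {x \<in> fst c. F x \<in> fst d})"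
      using F by (intro open_chart_preimage_image c chart_open d) (simp add: Cr_map_def)
    ultimately have "Cr_on r T (\<lambda>q. in_charts c d F (snd q))"
      using T(1,3) by (intro Cr_on_comp[where F = "in_charts c d F" and G = snd] Cr_on_bounded_linear[OF bounded_linear_snd]) auto
    then show ?thesis using T by (intro exI[of _ T] exI conjI) (auto simp: in_charts_apply)
  qed
qed

end

text \<open>The joint statements for \<open>F = id\<close> are sliced at a fixed parameter;
  continuity, too, comes from the openness of \<open>\<Omega>\<close>.\<close>

lemma Cr_map_lift:
  assumes t: "t \<in> I"
  shows "Cr_map r X A (lift t)"
  unfolding Cr_map_def
proof (intro conjI ballI)
  have slice: "{y. (t, y) \<in> \<Omega> id c V} = snd c ` {x \<in> fst c. lift t x \<in> V}" if "c \<in> A" for c V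
    using t chart_inv_left[OF that] by (auto simp: \<Omega>_def[OF Cr_map_id that] )
  show "continuous_map X X (lift t)"
    unfolding continuous_map_def
  proof (intro conjI allI impI)
    show "lift t \<in> topspace X \<rightarrow> topspace X"
      using chart_topspace[OF c0] chart_inv_mem[OF c0] \<Phi>_into[OF t] by (auto simp: lift_chart_def)
    fix V assume V: "openin X V"
    have "\<exists>T. openin X T \<and> x \<in> T \<and> T \<subseteq> {x \<in> topspace X. lift t x \<in> V}"
      if x: "x \<in> topspace X" "lift t x \<in> V" for x
    proof -
      obtain c where c: "c \<in> A" "x \<in> fst c" using chart_at x by blast
      have "open {y. (t, y) \<in> \<Omega> id c V}"
        using open_vimage[OF open_family[OF Cr_map_id c(1) V], of "Pair t"] by (simp add: vimage_def continuous_on_Pair)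
      then have "openin X {x \<in> fst c. snd c x \<in> {y. (t, y) \<in> \<Omega> id c V}}"
        by (rule open_chart_preimage[OF c(1)])
      moreover have "{x \<in> fst c. snd c x \<in> {y. (t, y) \<in> \<Omega> id c V}} = {x \<in> fst c. lift t x \<in> V}"
        unfolding slice[OF c(1)] using inj_onD[OF chart_inj[OF c(1)]] by blast
      ultimately show ?thesis using c x chart_topspace[OF c(1)] by (intro exI[of _ "{x \<in> fst c. lift t x \<in> V}"]) auto
    qed
    then show "openin X {x \<in> topspace X. lift t x \<in> V}" by (subst openin_subopen) blast
  qed
  fix c d assume c: "c \<in> A" and d: "d \<in> A"
  show "Cr_on r (snd c ` {x \<in> fst c. lift t x \<in> fst d}) (in_charts c d (lift t))"
    using Cr_on_slice[OF Cr_on_family[OF Cr_map_id c d] open_family[OF Cr_map_id c chart_open[OF d]], of t]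
    by (simp add: slice[OF c] in_charts_def comp_def)
qed

end

context smooth_mfd
begin

text \<open>If \<open>\<phi> y\<close> lies outside the ball it is fixed by \<open>\<phi>\<close>,
  and injectivity gives \<open>\<phi> y = y\<close>; hence the chart image is preserved. Regularity
  is then the case of a constant family.\<close>

lemma lift_chart_Cr_map:
  assumes c: "c \<in> A" and K: "cball a \<rho> \<subseteq> snd c ` fst c" and \<phi>: "Cr_on r UNIV \<phi>"
    and inj: "inj \<phi>" and supp: "\<And>x. \<rho> < dist a x \<Longrightarrow> \<phi> x = x"
  shows "\<phi> ` (snd c ` fst c) \<subseteq> snd c ` fst c" "Cr_map r X A (lift_chart c \<phi>)"
proof -
  show into: "\<phi> ` (snd c ` fst c) \<subseteq> snd c ` fst c"
  proof
    fix z assume "z \<in> \<phi> ` (snd c ` fst c)"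
    then obtain y where y: "y \<in> snd c ` fst c" "z = \<phi> y" by blast
    show "z \<in> snd c ` fst c"
    proof (cases "z \<in> cball a \<rho>")
      case False
      then have "\<phi> z = z" by (intro supp) simp
      then have "z = y" using injD[OF inj] y(2) by simp
      then show ?thesis using y by simp
    qed (use K in blast)
  qed
  have "Cr_on r UNIV (\<lambda>p :: real \<times> 'e. \<phi> (snd p))"
    by (rule Cr_on_comp[OF \<phi> Cr_on_bounded_linear[OF bounded_linear_snd]]) auto
  then interpret chart_family X A r c a \<rho> "\<lambda>p. \<phi> (snd p)" UNIV
    using into by unfold_locales (use c K supp in auto)
  show "Cr_map r X A (lift_chart c \<phi>)" using Cr_map_lift[of 0] by simp
qed

text \<open>The inverse of \<open>f\<close> followed by the lift of \<open>\<psi>\<close>, which has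
  the same support, is the inverse on \<open>topspace X\<close>.\<close>

lemma lift_chart_Diff:
  assumes f: "f \<in> Diff r X A" and c: "c \<in> A" and K: "cball a \<rho> \<subseteq> snd c ` fst c"
    and \<phi>: "Cr_on r UNIV \<phi>" "Cr_on r UNIV \<psi>" "\<And>x. \<psi> (\<phi> x) = x" "\<And>x. \<phi> (\<psi> x) = x"
    and supp: "\<And>x. \<rho> < dist a x \<Longrightarrow> \<phi> x = x"
  shows "f \<circ> lift_chart c \<phi> \<in> Diff r X A"
proof -
  let ?l = "lift_chart c \<phi>" and ?k = "lift_chart c \<psi>" and ?T = "topspace X"
  have "inj \<phi>" "inj \<psi>" using \<phi>(3,4) by (metis injI)+
  have supp': "\<psi> x = x" if "\<rho> < dist a x" for x using supp[OF that] \<phi>(3)[of x] by simp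
  note l = lift_chart_Cr_map[OF c K \<phi>(1) \<open>inj \<phi>\<close> supp]
  note k = lift_chart_Cr_map[OF c K \<phi>(2) \<open>inj \<psi>\<close> supp']
  have kl: "?k (?l x) = x" and lk: "?l (?k x) = x" for x
    using l(1) k(1) \<phi>(3,4) chart_inv_left[OF c] chart_inv_mem[OF c] chart_inv_right[OF c]
    by (auto simp: lift_chart_def image_subset_iff)
  have l_top: "?l x \<in> ?T" and k_top: "?k x \<in> ?T" if "x \<in> ?T" for x
    using l(2) k(2) that by (auto simp: Cr_map_def continuous_map_def)
  have bl: "bij_betw ?l ?T ?T"
    by (rule bij_betw_byWitness[of _ ?k]) (use kl lk l_top k_top in auto)
  have f': "f \<in> extensional ?T" "bij_betw f ?T ?T" "Cr_map r X A f" "Cr_map r X A (inv_into ?T f)"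
    using f by (auto simp: Diff_def)
  have bij: "bij_betw (f \<circ> ?l) ?T ?T" using bl f'(2) by (rule bij_betw_trans)
  have "f \<circ> ?l \<in> extensional ?T"
    using f'(1) chart_topspace[OF c] by (auto simp: extensional_def lift_chart_def)
  moreover have "Cr_map r X A (inv_into ?T (f \<circ> ?l))"
  proof (rule Cr_map_cong[OF Cr_map_comp[OF f'(4) k(2)]])
    fix x assume x: "x \<in> ?T"
    have "inv_into ?T f x \<in> ?T" using f'(2) x by (metis bij_betw_imp_surj_on inv_into_into)
    moreover have "f (inv_into ?T f x) = x" using f'(2) x by (simp add: bij_betw_inv_into_right)
    ultimately show "(?k \<circ> inv_into ?T f) x = inv_into ?T (f \<circ> ?l) x"
      using bij_betw_imp_inj_on[OF bij] k_top by (intro inv_into_f_eq[symmetric]) (auto simp: lk)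
  qed
  ultimately show ?thesis using bij Cr_map_comp[OF l(2) f'(3)] by (simp add: Diff_def)
qed

end

section \<open>Convergence of the perturbations in the \<open>C^r\<close> topology\<close>

context chart_family
begin

text \<open>For a fixed list of directions, closeness of derivatives is an open condition on
  \<open>(t, y)\<close> that holds for \<open>t = 0\<close> and \<open>y\<close> in the compact
  coordinate image of \<open>K\<close>. The tube lemma makes it hold for all small \<open>t\<close>,
  and only finitely many lists of basis vectors have length at most \<open>k\<close>.\<close>

lemma eventually_perturbation:
  assumes zero: "0 \<in> I" "\<And>x. \<Phi> (0, x) = x"
    and inv: "\<And>t. t \<in> I \<Longrightarrow> \<exists>\<psi>. Cr_on r UNIV \<psi> \<and> (\<forall>x. \<psi> (\<Phi> (t, x)) = x) \<and> (\<forall>x. \<Phi> (t, \<psi> x) = x)"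
    and f: "f \<in> Diff r X A"
    and W: "openin (Cr_topology r X A) W" "f \<in> W"
  shows "\<forall>\<^sub>F t in nhds 0. f \<circ> lift t \<in> W"
proof -
  have ev_I: "\<forall>\<^sub>F t in nhds 0. t \<in> I" using I zero eventually_nhds by blast
  have slice_Cr: "Cr_on r UNIV (\<lambda>x. \<Phi> (t, x))" for t
    using Cr_on_slice[OF \<Phi>_Cr open_UNIV, of t] by simp
  have diff: "f \<circ> lift t \<in> Diff r X A" if t: "t \<in> I" for t
  proof -
    obtain \<psi> where "Cr_on r UNIV \<psi>" "\<And>x. \<psi> (\<Phi> (t, x)) = x" "\<And>x. \<Phi> (t, \<psi> x) = x"
      using inv[OF t] by blast
    then show ?thesis
      by (intro lift_chart_Diff[OF f c0 cball slice_Cr]) (auto simp: \<Phi>_supp)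
  qed
  have lift0: "lift 0 x = x" for x
    by (simp add: lift_chart_def zero chart_inv_left[OF c0])
  have fC: "Cr_map r X A f" and cf: "continuous_map X X f" using f by (auto simp: Diff_def Cr_map_def)
  \<comment> \<open>The centre \<open>f'\<close> may differ from \<open>f\<close>: what is known at
    \<open>t = 0\<close> is the strict inequality expressing membership of \<open>f\<close>, not
    equality of derivatives.\<close>
  have nbhd: "\<forall>\<^sub>F t in nhds 0. f \<circ> lift t \<in> Cr_nbhd r X A f' c d K k \<epsilon>"
    if fn: "f \<in> Cr_nbhd r X A f' c d K k \<epsilon>" and f': "f' \<in> Diff r X A" and c: "c \<in> A" and d: "d \<in> A"
      and K: "compactin X K" "K \<subseteq> fst c" "f' ` K \<subseteq> fst d" and k: "enat k \<le> r"
    for f' c d K k \<epsilon>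
  proof -
    define G where "G p = snd d (f (lift (fst p) (chart_inv c (snd p))))" for p
    let ?O = "\<Omega> f c (fst d)"
    have GC: "Cr_on r ?O G" unfolding G_def by (rule Cr_on_family[OF fC c d])
    have oO: "open ?O" by (rule open_family[OF fC c chart_open[OF d]])
    let ?K = "snd c ` K"
    have cK: "compact ?K" by (rule compact_chart_image[OF c K(1,2)])
    have G0: "G (0, y) = in_charts c d f y" for y by (simp add: G_def lift0 in_charts_apply)
    have KO: "(0, y) \<in> ?O" if y: "y \<in> ?K" for y
    proof -
      obtain x where x: "x \<in> K" "y = snd c x" using y by blast
      moreover have "x \<in> fst c" "f x \<in> fst d" using x(1) fn K by (auto simp: Cr_nbhd_def)
      ultimately show ?thesis using zero(1) by (simp add: \<Omega>_def[OF fC c] lift0 chart_inv_left[OF c])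
    qed
    let ?S = "snd c ` {x \<in> fst c. f' x \<in> fst d}"
    let ?N = "\<lambda>vs p. norm (iter_deriv (map (Pair 0) vs) G p - iter_deriv vs (in_charts c d f') (snd p))"
    let ?L = "{vs. set vs \<subseteq> (Basis :: 'e set) \<and> length vs \<le> k}"
    have "finite ?L" by (intro finite_lists_length_le) auto
    moreover have "\<forall>\<^sub>F t in nhds 0. \<forall>y\<in>?K. (t, y) \<in> ?O \<and> ?N vs (t, y) < \<epsilon>" if vs: "vs \<in> ?L" for vs
    proof -
      have len: "enat (length vs) \<le> r" by (rule order.trans[OF _ k]) (use vs in simp)
      let ?R = "?O \<inter> (UNIV \<times> ?S)"
      have oS: "open ?S"
        using f' by (intro open_chart_preimage_image c chart_open d) (auto simp: Diff_def Cr_map_def)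
      have oR: "open ?R" by (intro open_Int oO open_Times oS open_UNIV)
      have 1: "continuous_on ?R (iter_deriv (map (Pair 0) vs) G)"
        by (rule continuous_on_subset[OF Cr_on_iter_deriv_continuous[OF GC]]) (use len in auto)
      have "continuous_on ?S (iter_deriv vs (in_charts c d f'))"
        using f' c d by (intro Cr_on_iter_deriv_continuous[OF _ len]) (auto simp: Diff_def Cr_map_def)
      then have 2: "continuous_on ?R (\<lambda>p. iter_deriv vs (in_charts c d f') (snd p))"
        by (rule continuous_on_compose2[OF _ continuous_on_snd[OF continuous_on_id]]) auto
      have oP: "open (?R \<inter> ?N vs -` {..<\<epsilon>})"
        by (rule continuous_open_preimage[OF continuous_on_norm[OF continuous_on_diff[OF 1 2]] oR]) auto
      have "{0 :: real} \<times> ?K \<subseteq> ?R \<inter> ?N vs -` {..<\<epsilon>}"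
      proof
        fix p assume "p \<in> {0 :: real} \<times> ?K"
        then obtain y where y: "y \<in> ?K" "p = (0, y)" by auto
        have "iter_deriv (map (Pair 0) vs) G (0, y) = iter_deriv vs (in_charts c d f) y"
          using iter_deriv_slice[OF GC oO len KO[OF y(1)]] by (simp add: G0)
        then have "?N vs (0, y) < \<epsilon>" using fn y(1) vs by (auto simp: Cr_nbhd_def)
        moreover have "?K \<subseteq> ?S" using K by blast
        ultimately show "p \<in> ?R \<inter> ?N vs -` {..<\<epsilon>}" using KO y by auto
      qed
      from Elementary_Topology.tube_lemma[OF cK oP this] obtain T where T: "0 \<in> T" "open T" "T \<times> ?K \<subseteq> ?R \<inter> ?N vs -` {..<\<epsilon>}"
        by blast
      have "(t, y) \<in> ?O \<and> ?N vs (t, y) < \<epsilon>" if "t \<in> T" "y \<in> ?K" for t y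
        using subsetD[OF T(3), of "(t, y)"] that by simp
      then show ?thesis using T(1,2) unfolding eventually_nhds by blast
    qed
    ultimately have "\<forall>\<^sub>F t in nhds 0. \<forall>vs\<in>?L. \<forall>y\<in>?K. (t, y) \<in> ?O \<and> ?N vs (t, y) < \<epsilon>"
      by (rule eventually_ball_finite[OF _ ballI])
    with ev_I show ?thesis
    proof eventually_elim
      case (elim t)
      \<comment> \<open>The empty list belongs to \<open>?L\<close>, so membership in the domain can
        be read off from its instance.\<close>
      have tO: "(t, y) \<in> ?O" if "y \<in> ?K" for y using elim(2) that by (auto dest: spec[of _ "[]"])
      have "(f \<circ> lift t) ` K \<subseteq> fst d"
      proof
        fix z assume "z \<in> (f \<circ> lift t) ` K"
        then obtain x where x: "x \<in> K" "z = f (lift t x)" by auto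
        then show "z \<in> fst d" using tO[of "snd c x"] K(2)
          by (auto simp: \<Omega>_def[OF fC c] chart_inv_left[OF c] subset_iff)
      qed
      moreover have "norm (iter_deriv vs (in_charts c d (f \<circ> lift t)) y - iter_deriv vs (in_charts c d f') y) < \<epsilon>"
        if "y \<in> ?K" "vs \<in> ?L" for y vs
      proof -
        have len: "enat (length vs) \<le> r" by (rule order.trans[OF _ k]) (use that in simp)
        have "in_charts c d (f \<circ> lift t) = (\<lambda>y. G (t, y))" by (auto simp: in_charts_apply G_def)
        then have "iter_deriv vs (in_charts c d (f \<circ> lift t)) y = iter_deriv (map (Pair 0) vs) G (t, y)"
          using iter_deriv_slice[OF GC oO len tO[OF that(1)]] by simp
        then show ?thesis using elim(2) that by auto
      qed
      ultimately show ?case using diff[OF elim(1)] by (auto simp: Cr_nbhd_def)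
    qed
  qed
  \<comment> \<open>Open sets arise from the subbase by finite intersections and arbitrary unions,
    and eventual membership passes through both.\<close>
  have "generate_topology_on (insert (Diff r X A) {Cr_nbhd r X A f c d K k \<epsilon> | f c d K k \<epsilon>.
        f \<in> Diff r X A \<and> c \<in> A \<and> d \<in> A \<and> compactin X K \<and> K \<subseteq> fst c \<and> f ` K \<subseteq> fst d \<and>
        enat k \<le> r \<and> 0 < \<epsilon>}) W"
    using W(1) unfolding Cr_topology_def openin_topology_generated_by_iff .
  then show ?thesis using W(2)
  proof induction
    case (Int a b)
    then show ?case by (auto intro: eventually_conj)
  next
    case (UN K)
    then obtain w where w: "w \<in> K" "f \<in> w" by blast
    then have "\<forall>\<^sub>F t in nhds 0. f \<circ> lift t \<in> w" using UN by blast
    then show ?case by (rule eventually_mono) (use w in blast)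
  next
    case (Basis s)
    then show ?case
    proof (elim insertE)
      assume s: "s = Diff r X A"
      show ?thesis unfolding s using ev_I by (rule eventually_mono) (rule diff)
    next
      assume "s \<in> {Cr_nbhd r X A f c d K k \<epsilon> | f c d K k \<epsilon>.
        f \<in> Diff r X A \<and> c \<in> A \<and> d \<in> A \<and> compactin X K \<and> K \<subseteq> fst c \<and> f ` K \<subseteq> fst d \<and>
        enat k \<le> r \<and> 0 < \<epsilon>}"
      then obtain f' c d K k \<epsilon> where s: "s = Cr_nbhd r X A f' c d K k \<epsilon>"
        and "f' \<in> Diff r X A" "c \<in> A" "d \<in> A" "compactin X K" "K \<subseteq> fst c" "f' ` K \<subseteq> fst d" "enat k \<le> r"
        by blast
      then show ?thesis using Basis.prems unfolding s by (intro nbhd)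
    qed
  qed simp
qed

end

section \<open>Persistence of contracting periodic points\<close>

lemma mult_min_half_le: "0 < c \<Longrightarrow> c * min a (b / (2 * c)) \<le> b / (2 :: real)"
  by (simp add: min_mult_distrib_left)

context smooth_mfd
begin

text \<open>A uniform form of strict differentiability at \<open>x\<close>, with derivative \<open>L\<close> in charts, of the maps \<open>T h\<close> for
  \<open>h\<close> close to \<open>g\<close>. Unlike closeness of the derivatives it is immediately stable under composition.\<close>

definition robust_derivative ::
    "enat \<Rightarrow> ('m \<Rightarrow> 'm) \<Rightarrow> (('m \<Rightarrow> 'm) \<Rightarrow> 'm \<Rightarrow> 'm) \<Rightarrow> ('m, 'e) chart \<Rightarrow> ('m, 'e) chart \<Rightarrow> 'm \<Rightarrow> ('e \<Rightarrow> 'e) \<Rightarrow> bool" where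
  "robust_derivative r g T c d x L \<longleftrightarrow> bounded_linear L \<and>
     (\<forall>\<epsilon>>0. \<exists>\<delta>>0. \<exists>V. openin (Cr_topology r X A) V \<and> g \<in> V \<and>
        (\<forall>h\<in>V. \<forall>y\<in>ball (snd c x) \<delta>. y \<in> snd c ` fst c \<and> T h (chart_inv c y) \<in> fst d \<and>
          (\<forall>z\<in>ball (snd c x) \<delta>.
            norm (in_charts c d (T h) y - in_charts c d (T h) z - L (y - z)) \<le> \<epsilon> * norm (y - z)))) \<and>
     (\<forall>\<eta>>0. \<exists>V. openin (Cr_topology r X A) V \<and> g \<in> V \<and>
        (\<forall>h\<in>V. norm (in_charts c d (T h) (snd c x) - in_charts c d (T g) (snd c x)) < \<eta>))"

lemma robust_derivativeE:
  assumes "robust_derivative r g T c d x L" "0 < \<epsilon>"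
  obtains \<delta> V where "0 < \<delta>" "openin (Cr_topology r X A) V" "g \<in> V"
    "\<And>h y. h \<in> V \<Longrightarrow> y \<in> ball (snd c x) \<delta> \<Longrightarrow> y \<in> snd c ` fst c"
    "\<And>h y. h \<in> V \<Longrightarrow> y \<in> ball (snd c x) \<delta> \<Longrightarrow> T h (chart_inv c y) \<in> fst d"
    "\<And>h y z. h \<in> V \<Longrightarrow> y \<in> ball (snd c x) \<delta> \<Longrightarrow> z \<in> ball (snd c x) \<delta> \<Longrightarrow>
      norm (in_charts c d (T h) y - in_charts c d (T h) z - L (y - z)) \<le> \<epsilon> * norm (y - z)"
  using assms unfolding robust_derivative_def by metis

lemma robust_derivative_valueE:
  assumes "robust_derivative r g T c d x L" "0 < \<eta>"
  obtains V where "openin (Cr_topology r X A) V" "g \<in> V"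
    "\<And>h. h \<in> V \<Longrightarrow> norm (in_charts c d (T h) (snd c x) - in_charts c d (T g) (snd c x)) < \<eta>"
  using assms unfolding robust_derivative_def by metis

text \<open>Specialising to \<open>h = g\<close>, with the centre as second point, gives ordinary
  differentiability. Uniqueness of derivatives then identifies \<open>L\<close> with a derivative
  computed by other means.\<close>

lemma robust_derivative_has_derivative:
  assumes "robust_derivative r g T c d x L"
  shows "(in_charts c d (T g) has_derivative L) (at (snd c x))"
  unfolding has_derivative_at_alt
proof (intro conjI allI impI)
  show "bounded_linear L" using assms by (simp add: robust_derivative_def)
  fix e :: real assume "0 < e"
  from robust_derivativeE[OF assms this] obtain \<delta> V where \<delta>: "0 < \<delta>" and V: "g \<in> V"
    "\<And>h y z. h \<in> V \<Longrightarrow> y \<in> ball (snd c x) \<delta> \<Longrightarrow> z \<in> ball (snd c x) \<delta> \<Longrightarrow>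
      norm (in_charts c d (T h) y - in_charts c d (T h) z - L (y - z)) \<le> e * norm (y - z)"
    by metis
  have "norm (in_charts c d (T g) y - in_charts c d (T g) (snd c x) - L (y - snd c x)) \<le> e * norm (y - snd c x)"
    if "norm (y - snd c x) < \<delta>" for y
    using V(2)[OF V(1), of y "snd c x"] that \<delta> by (simp add: dist_norm norm_minus_commute)
  then show "\<exists>d'>0. \<forall>y. norm (y - snd c x) < d' \<longrightarrow>
      norm (in_charts c d (T g) y - in_charts c d (T g) (snd c x) - L (y - snd c x)) \<le> e * norm (y - snd c x)"
    using \<delta> by blast
qed

section \<open>Uniform differentiability of a map and of its iterates\<close>

lemma openin_Cr_nbhd:
  assumes "f \<in> Diff r X A" "c \<in> A" "d \<in> A" "compactin X K" "K \<subseteq> fst c" "f ` K \<subseteq> fst d" "enat k \<le> r" "0 < \<epsilon>"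
  shows "openin (Cr_topology r X A) (Cr_nbhd r X A f c d K k \<epsilon>)" "f \<in> Cr_nbhd r X A f c d K k \<epsilon>"
proof -
  show "openin (Cr_topology r X A) (Cr_nbhd r X A f c d K k \<epsilon>)"
    unfolding Cr_topology_def by (rule topology_generated_by_Basis) (use assms in blast)
  show "f \<in> Cr_nbhd r X A f c d K k \<epsilon>" using assms by (simp add: Cr_nbhd_def)
qed

text \<open>The mean value inequality is applied to \<open>in_charts c d h\<close> minus its
  candidate derivative. The derivative of this difference is a sum of two small terms:
  \<open>h\<close> is \<open>C^1\<close>-close to \<open>g\<close> on a compact ball, and the
  derivative of \<open>g\<close> is close to its value at the centre.\<close>

lemma robust_derivative_self:
  assumes g: "g \<in> Diff r X A" and r: "1 \<le> r" and c: "c \<in> A" and d: "d \<in> A" and x: "x \<in> fst c" "g x \<in> fst d"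
  shows "robust_derivative r g (\<lambda>h. h) c d x (frechet_derivative (in_charts c d g) (at (snd c x)))"
  unfolding robust_derivative_def
proof (intro conjI allI impI)
  let ?S = "\<lambda>h. snd c ` {x \<in> fst c. h x \<in> fst d}"
  let ?y = "snd c x" and ?G = "in_charts c d g"
  let ?L = "frechet_derivative ?G (at ?y)"
  have hC: "Cr_on r (?S h) (in_charts c d h)" if "h \<in> Diff r X A" for h
    using that c d by (auto simp: Diff_def Cr_map_def)
  have hS: "open (?S h)" if "h \<in> Diff r X A" for h
    using that by (intro open_chart_preimage_image c chart_open d) (auto simp: Diff_def Cr_map_def)
  have yS: "?y \<in> ?S g" using x by auto
  have L: "(?G has_derivative ?L) (at ?y)" by (rule Cr_on_has_derivative[OF hC[OF g] r yS])
  then show bl: "bounded_linear ?L" by (rule has_derivative_bounded_linear)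
  {
    fix \<epsilon> :: real assume \<epsilon>: "0 < \<epsilon>"
    \<comment> \<open>Two errors of \<open>\<epsilon>1\<close> occur on each basis vector, and
      passing to all vectors costs the factor \<open>DIM('e)\<close>.\<close>
    define \<epsilon>1 where "\<epsilon>1 = \<epsilon> / (2 * DIM('e))"
    have \<epsilon>1: "0 < \<epsilon>1" "DIM('e) * (2 * \<epsilon>1) = \<epsilon>" using \<epsilon> by (auto simp: \<epsilon>1_def)
    have "\<forall>\<^sub>F z in nhds ?y. norm (frechet_derivative ?G (at z) b - ?L b) < \<epsilon>1" for b
    proof -
      have "enat (length [b]) \<le> r" using r by (simp add: one_enat_def)
      then have "continuous_on (?S g) (iter_deriv [b] ?G)"
        by (rule Cr_on_iter_deriv_continuous[OF hC[OF g]])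
      then have "isCont (iter_deriv [b] ?G) ?y"
        using hS[OF g] yS continuous_on_eq_continuous_at by blast
      then have "(iter_deriv [b] ?G \<longlongrightarrow> iter_deriv [b] ?G ?y) (nhds ?y)"
        by (simp only: isCont_def tendsto_at_iff_tendsto_nhds)
      then show ?thesis using \<epsilon>1(1) by (auto simp: tendsto_iff dist_norm)
    qed
    then have "\<forall>\<^sub>F z in nhds ?y. \<forall>b\<in>Basis. norm (frechet_derivative ?G (at z) b - ?L b) < \<epsilon>1"
      by (intro eventually_ball_finite) auto
    moreover have "\<forall>\<^sub>F z in nhds ?y. z \<in> ?S g" using hS[OF g] yS by (rule eventually_nhds_in_open)
    ultimately have "\<forall>\<^sub>F z in nhds ?y. z \<in> ?S g \<and> (\<forall>b\<in>Basis. norm (frechet_derivative ?G (at z) b - ?L b) < \<epsilon>1)"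
      by (rule eventually_conj[rotated])
    then obtain \<delta>1 where \<delta>1: "0 < \<delta>1"
      "\<And>z. dist z ?y < \<delta>1 \<Longrightarrow> z \<in> ?S g \<and> (\<forall>b\<in>Basis. norm (frechet_derivative ?G (at z) b - ?L b) < \<epsilon>1)"
      unfolding eventually_nhds_metric by blast
    \<comment> \<open>Halving makes the closed ball fit into the ball of radius
      \<open>\<delta>1\<close>; its compactness is what \<open>Cr_nbhd\<close> requires.\<close>
    define \<delta> where "\<delta> = \<delta>1 / 2"
    have \<delta>: "0 < \<delta>" using \<delta>1(1) by (simp add: \<delta>_def)
    have B: "z \<in> ?S g" "\<And>b. b \<in> Basis \<Longrightarrow> norm (frechet_derivative ?G (at z) b - ?L b) < \<epsilon>1"
      if "z \<in> cball ?y \<delta>" for z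
      using \<delta>1(2)[of z] \<delta>1(1) that by (auto simp: \<delta>_def dist_commute)
    let ?K = "chart_inv c ` cball ?y \<delta>"
    have sub: "cball ?y \<delta> \<subseteq> snd c ` fst c" using B(1) by blast
    have K: "?K \<subseteq> fst c" using sub chart_inv_mem[OF c] by blast
    have Kg: "g ` ?K \<subseteq> fst d"
    proof
      fix w assume "w \<in> g ` ?K"
      then obtain z where z: "z \<in> cball ?y \<delta>" "w = g (chart_inv c z)" by blast
      obtain u where "u \<in> fst c" "g u \<in> fst d" "z = snd c u" using B(1)[OF z(1)] by blast
      then show "w \<in> fst d" using z(2) by (simp add: chart_inv_left[OF c])
    qed
    have "compactin (top_of_set (snd c ` fst c)) (cball ?y \<delta>)" using sub by (simp add: compactin_subtopology)
    then have cK: "compactin X ?K" using chart_inv_continuous[OF c] image_compactin by blast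
    have "enat 1 \<le> r" using r by (simp add: one_enat_def)
    note V = openin_Cr_nbhd[OF g c d cK K Kg this \<epsilon>1(1)]
    let ?V = "Cr_nbhd r X A g c d ?K 1 \<epsilon>1"
    have into: "h (chart_inv c z) \<in> fst d" if "h \<in> ?V" "z \<in> ball ?y \<delta>" for h z
      using that by (auto simp: Cr_nbhd_def)
    have main: "norm (in_charts c d h y - in_charts c d h z - ?L (y - z)) \<le> \<epsilon> * norm (y - z)"
      if h: "h \<in> ?V" and yz: "y \<in> ball ?y \<delta>" "z \<in> ball ?y \<delta>" for h y z
    proof -
      let ?H = "in_charts c d h"
      let ?D = "\<lambda>u v. frechet_derivative ?H (at u) v - ?L v"
      have hD: "h \<in> Diff r X A" using h by (simp add: Cr_nbhd_def)
      have der: "((\<lambda>u. ?H u - ?L u) has_derivative ?D u) (at u)" if u: "u \<in> ball ?y \<delta>" for u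
      proof -
        have "u \<in> snd c ` fst c" using u sub by force
        then have "u \<in> ?S h" using into[OF h u] chart_inv_mem[OF c] chart_inv_right[OF c]
          by (intro image_eqI[of _ _ "chart_inv c u"]) auto
        then show ?thesis
          by (intro has_derivative_diff Cr_on_has_derivative[OF hC[OF hD] r] bounded_linear_imp_has_derivative bl)
      qed
      have "onorm (?D u) \<le> \<epsilon>" if u: "u \<in> ball ?y \<delta>" for u
      proof (rule onorm_le)
        fix v
        have "norm (?D u b) \<le> 2 * \<epsilon>1" if b: "b \<in> Basis" for b
        proof -
          have "u \<in> snd c ` fst c" using u sub by force
          then have uK: "u \<in> snd c ` ?K" using u chart_inv_right[OF c]
            by (intro image_eqI[of _ _ "chart_inv c u"]) auto
          have "\<forall>vs. set vs \<subseteq> Basis \<and> length vs \<le> 1 \<longrightarrow> norm (iter_deriv vs ?H u - iter_deriv vs ?G u) < \<epsilon>1"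
            using h uK unfolding Cr_nbhd_def by blast
          then have 1: "norm (iter_deriv [b] ?H u - iter_deriv [b] ?G u) < \<epsilon>1"
            using b by (auto dest: spec[of _ "[b]"])
          have "norm (?D u b) = norm ((iter_deriv [b] ?H u - iter_deriv [b] ?G u) + (frechet_derivative ?G (at u) b - ?L b))"
            by simp
          also have "\<dots> \<le> \<epsilon>1 + \<epsilon>1"
            using 1 B(2)[of u b] u b by (intro norm_triangle_mono) auto
          finally show ?thesis by simp
        qed
        then have "norm (?D u v) \<le> DIM('e) * (2 * \<epsilon>1) * norm v"
          using has_derivative_linear[OF der[OF u]] by (intro norm_linear_le_Basis) auto
        then show "norm (?D u v) \<le> \<epsilon> * norm v" by (simp only: \<epsilon>1(2))
      qed
      then have "norm ((?H y - ?L y) - (?H z - ?L z)) \<le> \<epsilon> * norm (y - z)"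
        by (intro differentiable_bound[of "ball ?y \<delta>" _ ?D] has_derivative_at_withinI[OF der] yz) auto
      then show ?thesis using bl by (simp add: bounded_linear.linear linear_diff algebra_simps)
    qed
    show "\<exists>\<delta>>0. \<exists>V. openin (Cr_topology r X A) V \<and> g \<in> V \<and>
        (\<forall>h\<in>V. \<forall>y\<in>ball ?y \<delta>. y \<in> snd c ` fst c \<and> h (chart_inv c y) \<in> fst d \<and>
          (\<forall>z\<in>ball ?y \<delta>. norm (in_charts c d h y - in_charts c d h z - ?L (y - z)) \<le> \<epsilon> * norm (y - z)))"
      using \<delta> V into main sub by (intro exI[of _ \<delta>] conjI exI[of _ ?V] ballI) auto
  next
    fix \<eta> :: real assume \<eta>: "0 < \<eta>"
    have "compactin X {x}" using chart_topspace[OF c x(1)] by (simp add: compactin_sing)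
    note V = openin_Cr_nbhd[OF g c d this, of 0 \<eta>]
    have "norm (in_charts c d h ?y - ?G ?y) < \<eta>" if "h \<in> Cr_nbhd r X A g c d {x} 0 \<eta>" for h
      using that by (auto simp: Cr_nbhd_def)
    then show "\<exists>V. openin (Cr_topology r X A) V \<and> g \<in> V \<and>
        (\<forall>h\<in>V. norm (in_charts c d h ?y - ?G ?y) < \<eta>)"
      using V x \<eta> by (intro exI[of _ "Cr_nbhd r X A g c d {x} 0 \<eta>"]) (auto simp flip: zero_enat_def)
  }
qed

text \<open>For nearby \<open>h\<close> the inner image must stay where the outer map is controlled.
  It is displaced by the change of value at the centre, which is why the definition carries a clause
  on values.\<close>

lemma robust_derivative_comp:
  assumes c: "c \<in> A" and d: "d \<in> A" and x: "x \<in> fst c" "T g x \<in> fst d"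
    and T: "robust_derivative r g T c d x L" and T': "robust_derivative r g T' d e (T g x) L'"
  shows "robust_derivative r g (\<lambda>h. T' h \<circ> T h) c e x (\<lambda>v. L' (L v))"
proof -
  let ?y = "snd c x" and ?y' = "snd d (T g x)"
  have bl: "bounded_linear L" and bl': "bounded_linear L'" using T T' by (auto simp: robust_derivative_def)
  obtain B where B: "0 < B" "\<And>v. norm (L v) \<le> B * norm v"
    using bounded_linear.pos_bounded[OF bl] by (metis mult.commute)
  obtain B' where B': "0 < B'" "\<And>v. norm (L' v) \<le> B' * norm v"
    using bounded_linear.pos_bounded[OF bl'] by (metis mult.commute)
  have val: "in_charts c d (T g) ?y = ?y'" by (simp add: in_charts_apply chart_inv_left[OF c x(1)])
  have comp: "in_charts c e (T' h \<circ> T h) z = in_charts d e (T' h) (in_charts c d (T h) z)"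
    if "T h (chart_inv c z) \<in> fst d" for h z
    using that by (simp add: in_charts_apply chart_inv_left[OF d])
  have lip: "norm (u - v) \<le> (B + \<epsilon>) * norm w" if "norm (u - v - L w) \<le> \<epsilon> * norm w" for u v w \<epsilon>
  proof -
    have "norm (u - v) = norm ((u - v - L w) + L w)" by simp
    also have "\<dots> \<le> \<epsilon> * norm w + B * norm w" by (intro norm_triangle_mono that B)
    finally show ?thesis by (simp add: algebra_simps)
  qed
  have lip': "norm (u - v) \<le> (B' + \<epsilon>) * norm w" if "norm (u - v - L' w) \<le> \<epsilon> * norm w" for u v w \<epsilon>
  proof -
    have "norm (u - v) = norm ((u - v - L' w) + L' w)" by simp
    also have "\<dots> \<le> \<epsilon> * norm w + B' * norm w" by (intro norm_triangle_mono that B')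
    finally show ?thesis by (simp add: algebra_simps)
  qed
  show ?thesis
    unfolding robust_derivative_def
  proof (intro conjI allI impI)
    show "bounded_linear (\<lambda>v. L' (L v))" using bl bl' bounded_linear_compose by blast
    fix \<epsilon> :: real assume \<epsilon>: "0 < \<epsilon>"
    \<comment> \<open>Half of \<open>\<epsilon>\<close> pays for the inner error magnified by
      \<open>L'\<close>, half for the outer error over the inner displacement. The bound
      \<open>\<epsilon>0 \<le> 1\<close> makes the inner Lipschitz constant at most
      \<open>B + 1\<close>.\<close>
    define \<epsilon>0 where "\<epsilon>0 = min 1 (\<epsilon> / (2 * B'))"
    define \<epsilon>1 where "\<epsilon>1 = \<epsilon> / (2 * (B + 1))"
    have \<epsilon>0: "0 < \<epsilon>0" "\<epsilon>0 \<le> 1" "B' * \<epsilon>0 \<le> \<epsilon> / 2"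
      using \<epsilon> B' mult_min_half_le[of B' 1 \<epsilon>] by (auto simp: \<epsilon>0_def)
    have \<epsilon>1: "0 < \<epsilon>1" "\<epsilon>1 * (B + 1) = \<epsilon> / 2" using \<epsilon> B by (auto simp: \<epsilon>1_def field_simps)
    from robust_derivativeE[OF T' \<epsilon>1(1)] obtain \<delta>1 V1 where V1: "0 < \<delta>1" "openin (Cr_topology r X A) V1" "g \<in> V1"
      "\<And>h y. h \<in> V1 \<Longrightarrow> y \<in> ball ?y' \<delta>1 \<Longrightarrow> T' h (chart_inv d y) \<in> fst e"
      "\<And>h y z. h \<in> V1 \<Longrightarrow> y \<in> ball ?y' \<delta>1 \<Longrightarrow> z \<in> ball ?y' \<delta>1 \<Longrightarrow>
        norm (in_charts d e (T' h) y - in_charts d e (T' h) z - L' (y - z)) \<le> \<epsilon>1 * norm (y - z)"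
      by metis
    from robust_derivativeE[OF T \<epsilon>0(1)] obtain \<delta>0 V0 where V0: "0 < \<delta>0" "openin (Cr_topology r X A) V0" "g \<in> V0"
      "\<And>h y. h \<in> V0 \<Longrightarrow> y \<in> ball ?y \<delta>0 \<Longrightarrow> y \<in> snd c ` fst c"
      "\<And>h y. h \<in> V0 \<Longrightarrow> y \<in> ball ?y \<delta>0 \<Longrightarrow> T h (chart_inv c y) \<in> fst d"
      "\<And>h y z. h \<in> V0 \<Longrightarrow> y \<in> ball ?y \<delta>0 \<Longrightarrow> z \<in> ball ?y \<delta>0 \<Longrightarrow>
        norm (in_charts c d (T h) y - in_charts c d (T h) z - L (y - z)) \<le> \<epsilon>0 * norm (y - z)"
      by metis
    have "0 < \<delta>1 / 2" using V1(1) by simp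
    from robust_derivative_valueE[OF T this] obtain V2 where V2: "openin (Cr_topology r X A) V2" "g \<in> V2"
      "\<And>h. h \<in> V2 \<Longrightarrow> norm (in_charts c d (T h) ?y - ?y') < \<delta>1 / 2"
      unfolding val by metis
    \<comment> \<open>Half of \<open>\<delta>1\<close> is left for the spread of the inner image,
      half for the displacement of its centre.\<close>
    define \<delta> where "\<delta> = min \<delta>0 (\<delta>1 / (2 * (B + 1)))"
    have \<delta>: "0 < \<delta>" "\<delta> \<le> \<delta>0" "(B + 1) * \<delta> \<le> \<delta>1 / 2"
      using V0(1) V1(1) B mult_min_half_le[of "B + 1" \<delta>0 \<delta>1] by (auto simp: \<delta>_def)
    let ?V = "V0 \<inter> V1 \<inter> V2"
    have H: "norm (in_charts c d (T h) y - in_charts c d (T h) z) \<le> (B + 1) * norm (y - z)"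
      if "h \<in> ?V" "y \<in> ball ?y \<delta>0" "z \<in> ball ?y \<delta>0" for h y z
    proof -
      have "norm (in_charts c d (T h) y - in_charts c d (T h) z) \<le> (B + \<epsilon>0) * norm (y - z)"
        using that by (intro lip V0(6)) auto
      also have "\<dots> \<le> (B + 1) * norm (y - z)" using \<epsilon>0 by (intro mult_right_mono) auto
      finally show ?thesis .
    qed
    have H_ball: "in_charts c d (T h) y \<in> ball ?y' \<delta>1" if "h \<in> ?V" "y \<in> ball ?y \<delta>" for h y
    proof -
      have "norm (in_charts c d (T h) y - ?y') = norm ((in_charts c d (T h) y - in_charts c d (T h) ?y) + (in_charts c d (T h) ?y - ?y'))"
        by simp
      also have "\<dots> \<le> norm (in_charts c d (T h) y - in_charts c d (T h) ?y) + norm (in_charts c d (T h) ?y - ?y')"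
        by (rule norm_triangle_ineq)
      also have "\<dots> < (B + 1) * norm (y - ?y) + \<delta>1 / 2"
        using H[of h y ?y] V2(3)[of h] that \<delta> V0(1) by auto
      also have "(B + 1) * norm (y - ?y) \<le> (B + 1) * \<delta>"
        using that B by (intro mult_left_mono) (auto simp: dist_norm norm_minus_commute)
      finally show ?thesis using \<delta>(3) by (simp add: dist_norm norm_minus_commute)
    qed
    have main: "norm (in_charts c e (T' h \<circ> T h) y - in_charts c e (T' h \<circ> T h) z - L' (L (y - z))) \<le> \<epsilon> * norm (y - z)"
      if h: "h \<in> ?V" and yz: "y \<in> ball ?y \<delta>" "z \<in> ball ?y \<delta>" for h y z
    proof -
      have yz0: "y \<in> ball ?y \<delta>0" "z \<in> ball ?y \<delta>0" using yz \<delta>(2) by auto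
      let ?u = "in_charts c d (T h) y" and ?v = "in_charts c d (T h) z"
      have 1: "norm (in_charts d e (T' h) ?u - in_charts d e (T' h) ?v - L' (?u - ?v)) \<le> \<epsilon>1 * norm (?u - ?v)"
        using h by (intro V1(5) H_ball yz) auto
      have 2: "norm (L' (?u - ?v - L (y - z))) \<le> B' * (\<epsilon>0 * norm (y - z))"
      proof (rule order.trans[OF B'(2)], rule mult_left_mono)
        show "norm (?u - ?v - L (y - z)) \<le> \<epsilon>0 * norm (y - z)" using h yz0 by (intro V0(6)) auto
      qed (use B' in simp)
      have "in_charts c e (T' h \<circ> T h) y - in_charts c e (T' h \<circ> T h) z - L' (L (y - z))
          = (in_charts d e (T' h) ?u - in_charts d e (T' h) ?v - L' (?u - ?v)) + L' (?u - ?v - L (y - z))"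
        using h yz0 V0(5) bl' by (simp add: comp bounded_linear.linear linear_diff)
      then have "norm (in_charts c e (T' h \<circ> T h) y - in_charts c e (T' h \<circ> T h) z - L' (L (y - z)))
          \<le> \<epsilon>1 * norm (?u - ?v) + B' * (\<epsilon>0 * norm (y - z))"
        using norm_triangle_mono[OF 1 2] by simp
      also have "\<dots> \<le> \<epsilon>1 * ((B + 1) * norm (y - z)) + B' * (\<epsilon>0 * norm (y - z))"
        using H[OF h yz0] \<epsilon>1(1) by simp
      also have "\<dots> = (\<epsilon>1 * (B + 1) + B' * \<epsilon>0) * norm (y - z)" by (simp add: algebra_simps)
      also have "\<dots> \<le> \<epsilon> * norm (y - z)" using \<epsilon>1(2) \<epsilon>0(3) by (intro mult_right_mono) auto
      finally show ?thesis .
    qed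
    have into: "y \<in> snd c ` fst c \<and> (T' h \<circ> T h) (chart_inv c y) \<in> fst e" if h: "h \<in> ?V" and y: "y \<in> ball ?y \<delta>" for h y
    proof -
      have y0: "y \<in> ball ?y \<delta>0" using y \<delta>(2) by auto
      have "T' h (chart_inv d (in_charts c d (T h) y)) \<in> fst e"
        using h by (intro V1(4) H_ball y) auto
      moreover have "T h (chart_inv c y) \<in> fst d" using h y0 V0(5) by blast
      moreover have "y \<in> snd c ` fst c" using h y0 V0(4) by blast
      ultimately show ?thesis by (simp add: in_charts_apply chart_inv_left[OF d])
    qed
    have Vo: "openin (Cr_topology r X A) ?V" "g \<in> ?V" using V0 V1 V2 by auto
    show "\<exists>\<delta>>0. \<exists>V. openin (Cr_topology r X A) V \<and> g \<in> V \<and>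
        (\<forall>h\<in>V. \<forall>y\<in>ball ?y \<delta>. y \<in> snd c ` fst c \<and> (T' h \<circ> T h) (chart_inv c y) \<in> fst e \<and>
          (\<forall>z\<in>ball ?y \<delta>. norm (in_charts c e (T' h \<circ> T h) y - in_charts c e (T' h \<circ> T h) z - L' (L (y - z)))
            \<le> \<epsilon> * norm (y - z)))"
      by (intro exI[of _ \<delta>] exI[of _ ?V] conjI ballI \<delta>(1) Vo main into[THEN conjunct1] into[THEN conjunct2])
  next
    fix \<eta> :: real assume \<eta>: "0 < \<eta>"
    from robust_derivativeE[OF T' zero_less_one] obtain \<delta>1 V1 where V1: "0 < \<delta>1" "openin (Cr_topology r X A) V1" "g \<in> V1"
      "\<And>h y z. h \<in> V1 \<Longrightarrow> y \<in> ball ?y' \<delta>1 \<Longrightarrow> z \<in> ball ?y' \<delta>1 \<Longrightarrow>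
        norm (in_charts d e (T' h) y - in_charts d e (T' h) z - L' (y - z)) \<le> 1 * norm (y - z)"
      by metis
    from robust_derivativeE[OF T zero_less_one] obtain \<delta>0 V0 where V0: "0 < \<delta>0" "openin (Cr_topology r X A) V0" "g \<in> V0"
      "\<And>h y. h \<in> V0 \<Longrightarrow> y \<in> ball ?y \<delta>0 \<Longrightarrow> T h (chart_inv c y) \<in> fst d"
      by metis
    \<comment> \<open>Half of \<open>\<eta>\<close> absorbs the inner displacement, magnified by the
      Lipschitz constant \<open>B' + 1\<close> of the outer map; the other half absorbs the change
      of the outer map at a fixed point.\<close>
    define \<theta> where "\<theta> = min \<delta>1 (\<eta> / (2 * (B' + 1)))"
    have \<theta>: "0 < \<theta>" "\<theta> \<le> \<delta>1" "(B' + 1) * \<theta> \<le> \<eta> / 2"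
      using V1(1) \<eta> B' mult_min_half_le[of "B' + 1" \<delta>1 \<eta>] by (auto simp: \<theta>_def)
    from robust_derivative_valueE[OF T \<theta>(1)] obtain V2 where V2: "openin (Cr_topology r X A) V2" "g \<in> V2"
      "\<And>h. h \<in> V2 \<Longrightarrow> norm (in_charts c d (T h) ?y - ?y') < \<theta>"
      unfolding val by metis
    have "0 < \<eta> / 2" using \<eta> by simp
    from robust_derivative_valueE[OF T' this] obtain V3 where V3: "openin (Cr_topology r X A) V3" "g \<in> V3"
      "\<And>h. h \<in> V3 \<Longrightarrow> norm (in_charts d e (T' h) ?y' - in_charts d e (T' g) ?y') < \<eta> / 2"
      by metis
    let ?V = "V0 \<inter> V1 \<inter> V2 \<inter> V3"
    have "norm (in_charts c e (T' h \<circ> T h) ?y - in_charts c e (T' g \<circ> T g) ?y) < \<eta>" if h: "h \<in> ?V" for h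
    proof -
      let ?u = "in_charts c d (T h) ?y"
      have u: "norm (?u - ?y') < \<theta>" using h V2 by blast
      have "norm (in_charts d e (T' h) ?u - in_charts d e (T' h) ?y') \<le> (B' + 1) * norm (?u - ?y')"
        using h u \<theta> V1(1) by (intro lip' V1(4)) (auto simp: dist_norm norm_minus_commute)
      also have "\<dots> \<le> (B' + 1) * \<theta>" using u B' by (intro mult_left_mono) auto
      also have "\<dots> \<le> \<eta> / 2" by (fact \<theta>)
      finally have 1: "norm (in_charts d e (T' h) ?u - in_charts d e (T' h) ?y') \<le> \<eta> / 2" .
      have "T h (chart_inv c ?y) \<in> fst d" using h V0 by auto
      then have "in_charts c e (T' h \<circ> T h) ?y - in_charts c e (T' g \<circ> T g) ?y
          = (in_charts d e (T' h) ?u - in_charts d e (T' h) ?y') + (in_charts d e (T' h) ?y' - in_charts d e (T' g) ?y')"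
        using x by (simp add: comp val chart_inv_left[OF c])
      then have "norm (in_charts c e (T' h \<circ> T h) ?y - in_charts c e (T' g \<circ> T g) ?y)
          \<le> norm (in_charts d e (T' h) ?u - in_charts d e (T' h) ?y') + norm (in_charts d e (T' h) ?y' - in_charts d e (T' g) ?y')"
        by (simp only: norm_triangle_ineq)
      also have "\<dots> < \<eta> / 2 + \<eta> / 2" using 1 h V3(3)[of h] by (intro add_le_less_mono) auto
      finally show ?thesis by simp
    qed
    moreover have "openin (Cr_topology r X A) ?V" "g \<in> ?V" using V0 V1 V2 V3 by auto
    ultimately show "\<exists>V. openin (Cr_topology r X A) V \<and> g \<in> V \<and>
        (\<forall>h\<in>V. norm (in_charts c e (T' h \<circ> T h) ?y - in_charts c e (T' g \<circ> T g) ?y) < \<eta>)"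
      by blast
  qed
qed

text \<open>Successive iterates of \<open>x\<close> may lie in different charts, so each step
  chooses a new intermediate chart. Only the existence of \<open>L\<close> is tracked, as its value
  can be recovered by uniqueness of derivatives.\<close>

lemma robust_derivative_funpow:
  assumes g: "g \<in> Diff r X A" and r: "1 \<le> r" and c: "c \<in> A" "x \<in> fst c" and d: "d \<in> A" "(g ^^ Suc n) x \<in> fst d"
  obtains L where "robust_derivative r g (\<lambda>h. h ^^ Suc n) c d x L"
  using d
proof (induction n arbitrary: d thesis)
  case 0
  have "robust_derivative r g (\<lambda>h. h) c d x (frechet_derivative (in_charts c d g) (at (snd c x)))"
    using 0 by (intro robust_derivative_self g r c) auto
  moreover have "(\<lambda>h :: 'm \<Rightarrow> 'm. h ^^ Suc 0) = (\<lambda>h. h)" by simp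
  ultimately show ?case using 0(1) by metis
next
  case (Suc n)
  have "x \<in> topspace X" using chart_topspace c by blast
  then have "(g ^^ k) x \<in> topspace X" for k
    using g by (induction k) (auto simp: Diff_def bij_betw_def)
  then obtain e where e: "e \<in> A" "(g ^^ Suc n) x \<in> fst e" using chart_at by blast
  obtain L where L: "robust_derivative r g (\<lambda>h. h ^^ Suc n) c e x L" using Suc.IH[OF _ e] by blast
  have L': "robust_derivative r g (\<lambda>h. h) e d ((g ^^ Suc n) x)
      (frechet_derivative (in_charts e d g) (at (snd e ((g ^^ Suc n) x))))"
    using Suc.prems by (intro robust_derivative_self g r e) auto
  have "(\<lambda>h :: 'm \<Rightarrow> 'm. h ^^ Suc (Suc n)) = (\<lambda>h. h \<circ> h ^^ Suc n)" by (simp only: funpow.simps)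
  then show ?case
    using Suc.prems(1) robust_derivative_comp[where T = "\<lambda>h. h ^^ Suc n", OF c(1) e(1) c(2) e(2) L L'] by (simp only:)
qed

text \<open>The contraction principle for \<open>h ^^ p\<close> on a fixed ball gives the point. All
  positive powers of \<open>h ^^ p\<close> contract the same ball towards it, so one
  \<open>V\<close> serves every \<open>m\<close>.\<close>

lemma persistent_periodic_point:
  assumes g: "g \<in> Diff r X A" and r: "1 \<le> r" and p: "0 < p" and c: "c \<in> A" "q \<in> fst c" and q: "(g ^^ p) q = q"
    and der: "(in_charts c c (g ^^ p) has_derivative (\<lambda>v. s *\<^sub>R v)) (at (snd c q))" and s: "0 \<le> s" "s < 1"
    and B: "openin X B" "q \<in> B"
  obtains V where "openin (Cr_topology r X A) V" "g \<in> V"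
    "\<And>h m. h \<in> V \<Longrightarrow> 0 < m \<Longrightarrow> Per0 X (p * m) h \<inter> B \<noteq> {}"
proof -
  let ?y = "snd c q"
  obtain p' where p': "p = Suc p'" using p by (cases p) auto
  obtain L where "robust_derivative r g (\<lambda>h. h ^^ p) c c q L"
    using robust_derivative_funpow[OF g r c c(1)] c(2) q unfolding p' by metis
  moreover from has_derivative_unique[OF robust_derivative_has_derivative[OF this] der]
  have "L = (\<lambda>v. s *\<^sub>R v)" .
  ultimately have R: "robust_derivative r g (\<lambda>h. h ^^ p) c c q (\<lambda>v. s *\<^sub>R v)" by simp
  \<comment> \<open>The midpoint of \<open>s\<close> and \<open>1\<close>: an error of
    \<open>(1 - s) / 2\<close> on top of \<open>s\<close> still leaves a contraction.\<close>
  define \<kappa> where "\<kappa> = (1 + s) / 2"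
  have \<kappa>: "0 \<le> \<kappa>" "\<kappa> < 1" "(1 - s) / 2 + s = \<kappa>" using s by (auto simp: \<kappa>_def field_simps)
  have "0 < (1 - s) / 2" using s by simp
  from robust_derivativeE[OF R this] obtain \<delta> V1 where V1: "0 < \<delta>" "openin (Cr_topology r X A) V1" "g \<in> V1"
    "\<And>h y. h \<in> V1 \<Longrightarrow> y \<in> ball ?y \<delta> \<Longrightarrow> (h ^^ p) (chart_inv c y) \<in> fst c"
    "\<And>h y z. h \<in> V1 \<Longrightarrow> y \<in> ball ?y \<delta> \<Longrightarrow> z \<in> ball ?y \<delta> \<Longrightarrow>
      norm (in_charts c c (h ^^ p) y - in_charts c c (h ^^ p) z - s *\<^sub>R (y - z)) \<le> (1 - s) / 2 * norm (y - z)"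
    by metis
  have "open (snd c ` (fst c \<inter> B))" "?y \<in> snd c ` (fst c \<inter> B)"
    using open_chart_image[OF c(1) B(1)] B(2) c(2) by auto
  then obtain \<rho>1 where \<rho>1: "0 < \<rho>1" "cball ?y \<rho>1 \<subseteq> snd c ` (fst c \<inter> B)" using open_contains_cball by blast
  define \<rho> where "\<rho> = min \<rho>1 (\<delta> / 2)"
  have \<rho>: "0 < \<rho>" "cball ?y \<rho> \<subseteq> snd c ` (fst c \<inter> B)" "cball ?y \<rho> \<subseteq> ball ?y \<delta>"
    using \<rho>1 V1(1) by (auto simp: \<rho>_def)
  \<comment> \<open>The image of the ball has radius at most \<open>\<kappa> * \<rho>\<close> about
    the image of its centre, so a displacement of the centre by less than the remainder keeps it in
    the open ball.\<close>
  have "0 < (1 - \<kappa>) * \<rho>" using \<kappa> \<rho> by simp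
  from robust_derivative_valueE[OF R this] obtain V2 where V2: "openin (Cr_topology r X A) V2" "g \<in> V2"
    "\<And>h. h \<in> V2 \<Longrightarrow> norm (in_charts c c (h ^^ p) ?y - ?y) < (1 - \<kappa>) * \<rho>"
    by (auto simp: in_charts_apply chart_inv_left[OF c] q)
  show thesis
  proof (rule that[of "V1 \<inter> V2"])
    show "openin (Cr_topology r X A) (V1 \<inter> V2)" "g \<in> V1 \<inter> V2" using V1 V2 by auto
    fix h :: "'m \<Rightarrow> 'm" and m :: nat
    assume h: "h \<in> V1 \<inter> V2" and m: "0 < m"
    let ?H = "in_charts c c (h ^^ p)"
    have lip: "norm (?H y - ?H z) \<le> \<kappa> * norm (y - z)" if "y \<in> cball ?y \<rho>" "z \<in> cball ?y \<rho>" for y z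
    proof -
      have "norm (?H y - ?H z) = norm ((?H y - ?H z - s *\<^sub>R (y - z)) + s *\<^sub>R (y - z))" by simp
      also have "\<dots> \<le> (1 - s) / 2 * norm (y - z) + s * norm (y - z)"
        using V1(5)[of h y z] h subsetD[OF \<rho>(3) that(1)] subsetD[OF \<rho>(3) that(2)] s
        by (intro norm_triangle_mono) auto
      also have "\<dots> = \<kappa> * norm (y - z)" by (simp only: \<kappa>(3)[symmetric] distrib_right)
      finally show ?thesis .
    qed
    have into: "?H y \<in> ball ?y \<rho>" if y: "y \<in> cball ?y \<rho>" for y
    proof -
      have "norm (?H y - ?y) \<le> norm (?H y - ?H ?y) + norm (?H ?y - ?y)"
        using norm_triangle_ineq[of "?H y - ?H ?y" "?H ?y - ?y"] by simp
      also have "\<dots> < \<kappa> * norm (y - ?y) + (1 - \<kappa>) * \<rho>"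
        using lip[OF y, of ?y] V2(3)[of h] h \<rho>(1) by auto
      also have "\<kappa> * norm (y - ?y) \<le> \<kappa> * \<rho>"
        using y \<kappa> by (intro mult_left_mono) (auto simp: dist_norm norm_minus_commute)
      finally show ?thesis by (simp add: dist_norm norm_minus_commute algebra_simps)
    qed
    have "\<exists>!z. z \<in> cball ?y \<rho> \<and> ?H z = z"
    proof (rule Banach_fix[OF _ _ \<kappa>(1,2)])
      show "?H ` cball ?y \<rho> \<subseteq> cball ?y \<rho>" using into ball_subset_cball by blast
    qed (use \<rho>(1) lip in \<open>auto simp: complete_eq_closed dist_norm\<close>)
    then obtain z where z: "z \<in> cball ?y \<rho>" "?H z = z" by blast
    have img: "y \<in> snd c ` fst c" if "y \<in> cball ?y \<rho>" for y using that \<rho>(2) by blast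
    have step: "(h ^^ p) (chart_inv c y) \<in> fst c" "snd c ((h ^^ p) (chart_inv c y)) = ?H y" if "y \<in> cball ?y \<rho>" for y
      using V1(4)[of h y] h that \<rho>(3) by (auto simp: in_charts_apply)
    define w where "w = chart_inv c z"
    have w: "w \<in> fst c" "snd c w = z"
      using chart_inv_mem[OF c(1) img[OF z(1)]] chart_inv_right[OF c(1) img[OF z(1)]] by (simp_all add: w_def)
    have "w \<in> B"
    proof -
      obtain u where "u \<in> fst c" "u \<in> B" "z = snd c u" using z(1) \<rho>(2) by blast
      then show ?thesis by (simp add: w_def chart_inv_left[OF c(1)])
    qed
    have "(h ^^ p) w = w"
      using step[OF z(1)] z(2) chart_inv_left[OF c(1) step(1)[OF z(1)]] by (simp add: w_def)
    then have "((h ^^ p) ^^ k) w = w" for k by (induction k) auto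
    then have w_per: "w \<in> Per X (p * m) h"
      using chart_topspace[OF c(1) w(1)] by (simp add: Per_def funpow_mult)
    let ?U = "{x \<in> fst c. snd c x \<in> ball ?y \<rho>}"
    have "openin X ?U" by (rule open_chart_preimage[OF c(1) open_ball])
    moreover have "?U \<inter> Per X (p * m) h = {w}"
    proof (intro equalityI subsetI)
      fix u assume "u \<in> ?U \<inter> Per X (p * m) h"
      then have u: "u \<in> fst c" "snd c u \<in> ball ?y \<rho>" "((h ^^ p) ^^ m) u = u"
        by (auto simp: Per_def funpow_mult)
      \<comment> \<open>Each step stays in the ball, so the estimate towards \<open>z\<close> can be
        iterated. Returning to \<open>u\<close> after \<open>m\<close> steps then forces the
        distance to \<open>z\<close> to vanish.\<close>
      have "((h ^^ p) ^^ k) u \<in> fst c \<and> snd c (((h ^^ p) ^^ k) u) \<in> cball ?y \<rho>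
          \<and> norm (snd c (((h ^^ p) ^^ k) u) - z) \<le> \<kappa> ^ k * norm (snd c u - z)" for k
      proof (induction k)
        case 0
        then show ?case using u by auto
      next
        case (Suc k)
        let ?v = "((h ^^ p) ^^ k) u"
        have v: "chart_inv c (snd c ?v) = ?v" using Suc.IH by (simp add: chart_inv_left[OF c(1)])
        have st: "(h ^^ p) ?v \<in> fst c" "snd c ((h ^^ p) ?v) = ?H (snd c ?v)"
          using step[of "snd c ?v"] Suc.IH unfolding v by auto
        have "norm (?H (snd c ?v) - z) \<le> \<kappa> * norm (snd c ?v - z)"
          using lip[of "snd c ?v" z] Suc.IH z by simp
        also have "\<dots> \<le> \<kappa> * (\<kappa> ^ k * norm (snd c u - z))" using Suc.IH \<kappa>(1) by (intro mult_left_mono) auto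
        finally show ?case using st into[of "snd c ?v"] Suc.IH by (auto simp: mult_ac)
      qed
      from this[of m] have "norm (snd c u - z) \<le> \<kappa> ^ m * norm (snd c u - z)" by (simp add: u(3))
      moreover have "\<kappa> ^ m < 1" using \<kappa> m by (simp add: power_less_one_iff)
      ultimately have "norm (snd c u - z) = 0"
        using mult_strict_right_mono[of "\<kappa> ^ m" 1 "norm (snd c u - z)"] by (cases "norm (snd c u - z) = 0") auto
      then show "u \<in> {w}" using chart_inv_left[OF c(1) u(1)] by (simp add: w_def)
    next
      fix u assume "u \<in> {w}"
      then show "u \<in> ?U \<inter> Per X (p * m) h" using w w_per into[OF z(1)] z(2) by auto
    qed
    ultimately have "w \<in> Per0 X (p * m) h" using w_per unfolding Per0_def by blast
    then show "Per0 X (p * m) h \<inter> B \<noteq> {}" using \<open>w \<in> B\<close> by blast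
  qed
qed

end

section \<open>Creating periodic points\<close>

context smooth_mfd
begin

lemma Diff_continuous_funpow:
  assumes "f \<in> Diff r X A" shows "continuous_map X X (f ^^ n)"
proof (induction n)
  case (Suc n)
  have "continuous_map X X f" using assms by (auto simp: Diff_def Cr_map_def)
  with Suc show ?case unfolding funpow.simps by (rule continuous_map_compose)
qed (simp add: id_def)

text \<open>The minimal period is bounded by \<open>N\<close> on \<open>U\<close> and cannot drop
  nearby, because the first iterates of a point stay separated from it. So it is constant near a
  point where it is maximal, and the same separation keeps \<open>U'\<close> off its first
  \<open>p - 1\<close> images.\<close>

lemma locally_constant_period:
  assumes f: "f \<in> Diff r X A" and U: "openin X U" "U \<noteq> {}" and N: "1 \<le> N" "\<And>x. x \<in> U \<Longrightarrow> (f ^^ N) x = x"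
  obtains p U' where "0 < p" "p dvd N" "openin X U'" "U' \<noteq> {}" "U' \<subseteq> U" "\<And>x. x \<in> U' \<Longrightarrow> (f ^^ p) x = x"
    "\<And>j x. 0 < j \<Longrightarrow> j < p \<Longrightarrow> x \<in> U' \<Longrightarrow> (f ^^ j) x \<notin> U'"
proof -
  define per where "per x = (LEAST p. 0 < p \<and> (f ^^ p) x = x)" for x
  have per: "0 < per x" "(f ^^ per x) x = x" "per x \<le> N" if "x \<in> U" for x
  proof -
    have "0 < N \<and> (f ^^ N) x = x" using N that by auto
    then show "0 < per x" "(f ^^ per x) x = x" "per x \<le> N"
      unfolding per_def by (metis (mono_tags, lifting) LeastI, metis (mono_tags, lifting) LeastI, metis (mono_tags, lifting) Least_le)
  qed
  have per_le: "per x \<le> j" if "0 < j" "(f ^^ j) x = x" for x j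
    unfolding per_def using that by (intro Least_le) auto
  obtain x where x: "x \<in> U" "\<And>y. y \<in> U \<Longrightarrow> per y \<le> per x"
  proof -
    obtain x0 where "x0 \<in> U" using U(2) by blast
    moreover have "\<forall>y. y \<in> U \<longrightarrow> per y < Suc N" using per(3) by (simp add: less_Suc_eq_le)
    ultimately show thesis using ex_has_greatest_nat[of "\<lambda>x. x \<in> U" x0 per "Suc N"] that by blast
  qed
  define p where "p = per x"
  have p: "0 < p" "(f ^^ p) x = x" using per[OF x(1)] by (auto simp: p_def)
  have xX: "x \<in> topspace X" using x(1) U(1) openin_subset by blast
  have "\<exists>O1 O2. openin X O1 \<and> openin X O2 \<and> x \<in> O1 \<and> (f ^^ j) x \<in> O2 \<and> disjnt O1 O2" if "j \<in> {0<..<p}" for j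
  proof -
    have "(f ^^ j) x \<noteq> x" using per_le[of j x] that by (auto simp: p_def)
    moreover have "(f ^^ j) x \<in> topspace X"
      using Diff_continuous_funpow[OF f, of j] xX by (auto simp: continuous_map_def)
    ultimately show ?thesis using Hausdorff xX unfolding Hausdorff_space_def by metis
  qed
  then obtain O1 O2 where O: "\<And>j. j \<in> {0<..<p} \<Longrightarrow> openin X (O1 j) \<and> openin X (O2 j) \<and> x \<in> O1 j \<and> (f ^^ j) x \<in> O2 j \<and> disjnt (O1 j) (O2 j)"
    by metis
  \<comment> \<open>For \<open>p = 1\<close> the index set is empty; the factor
    \<open>topspace X\<close> is the form in which a finite intersection is open in
    \<open>X\<close>.\<close>
  define U' where "U' = U \<inter> ((\<Inter>j\<in>{0<..<p}. O1 j \<inter> {y \<in> topspace X. (f ^^ j) y \<in> O2 j}) \<inter> topspace X)"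
  have notin: "(f ^^ j) y \<notin> U'" if "0 < j" "j < p" "y \<in> U'" for j y
  proof
    assume "(f ^^ j) y \<in> U'"
    with that have "(f ^^ j) y \<in> O1 j" "(f ^^ j) y \<in> O2 j" by (auto simp: U'_def)
    then show False using O[of j] that by (auto simp: disjnt_iff)
  qed
  show thesis
  proof (rule that[of p U'])
    \<comment> \<open>A nonzero remainder would be a period of \<open>x\<close> smaller than the
      minimal one.\<close>
    have "(f ^^ (N mod p)) x = x" using funpow_mod_eq[OF p(2), of N] N(2)[OF x(1)] by simp
    then have "N mod p = 0" using per_le[of "N mod p" x] p(1) by (metis leD mod_less_divisor not_gr_zero p_def)
    then show "p dvd N" by auto
    show "openin X U'"
      unfolding U'_def
      by (intro openin_Int U openin_INT openin_continuous_map_preimage[OF Diff_continuous_funpow[OF f]]) (use O in auto)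
    have "x \<in> U'" using x xX O by (auto simp: U'_def)
    then show "U' \<noteq> {}" by blast
    show "U' \<subseteq> U" by (auto simp: U'_def)
    fix y assume y: "y \<in> U'"
    then have yU: "y \<in> U" by (auto simp: U'_def)
    have "(f ^^ j) y \<noteq> y" if "0 < j" "j < p" for j using notin[OF that y] y by metis
    then have "p \<le> per y" using per[OF yU] by (metis not_less)
    then have "per y = p" using x(2)[OF yU] by (simp add: p_def)
    then show "(f ^^ p) y = y" using per[OF yU] by simp
  qed (use p notin in auto)
qed

text \<open>On \<open>U'\<close> the iterate \<open>g ^^ p\<close> is the lifted contraction itself,
  so the derivative at \<open>q\<close> is known exactly. The shell \<open>U1\<close> around the
  support keeps its periodicity and is the place for a further perturbation.\<close>

lemma create_periodic_point:
  assumes f: "f \<in> Diff r X A" and r: "1 \<le> r" and U: "openin X U" "U \<noteq> {}"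
    and N: "1 \<le> N" "\<And>x. x \<in> U \<Longrightarrow> (f ^^ N) x = x" and W: "openin (Cr_topology r X A) W" "f \<in> W"
  obtains g V B U1 where "g \<in> W" "openin X U1" "U1 \<noteq> {}" "U1 \<subseteq> U" "B \<subseteq> U" "B \<inter> U1 = {}"
    "\<And>x. x \<in> U1 \<Longrightarrow> (g ^^ N) x = x" "openin (Cr_topology r X A) V" "g \<in> V"
    "\<And>h m. h \<in> V \<Longrightarrow> 0 < m \<Longrightarrow> Per0 X (N * m) h \<inter> B \<noteq> {}"
proof -
  obtain p U' where p: "0 < p" "p dvd N" and U': "openin X U'" "U' \<noteq> {}" "U' \<subseteq> U"
    and fp: "\<And>x. x \<in> U' \<Longrightarrow> (f ^^ p) x = x" and disj: "\<And>j x. 0 < j \<Longrightarrow> j < p \<Longrightarrow> x \<in> U' \<Longrightarrow> (f ^^ j) x \<notin> U'"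
    by (rule locally_constant_period[OF f U N]) (assumption | rule that; assumption)+
  obtain q where q: "q \<in> U'" using U' by blast
  then have "q \<in> topspace X" using U' openin_subset by blast
  then obtain c where c: "c \<in> A" "q \<in> fst c" using chart_at by blast
  define a where "a = snd c q"
  let ?U = "snd c ` (fst c \<inter> U')"
  have "open ?U" "a \<in> ?U" using open_chart_image[OF c(1) U'(1)] c(2) q by (auto simp: a_def)
  then obtain R where R: "0 < R" "cball a R \<subseteq> ?U" using open_contains_cball by blast
  \<comment> \<open>A support of half the radius leaves the shell between \<open>\<rho>\<close> and
    \<open>R\<close> inside \<open>U'\<close>.\<close>
  define \<rho> where "\<rho> = R / 2"
  have \<rho>: "0 < \<rho>" "\<rho> < R" "cball a \<rho> \<subseteq> ?U" using R by (auto simp: \<rho>_def)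
  have K: "cball a \<rho> \<subseteq> snd c ` fst c" using \<rho>(3) by blast
  obtain \<Phi> :: "real \<times> 'e \<Rightarrow> 'e" and t0 where t0: "0 < t0" and \<Phi>: "Cr_on \<infinity> UNIV \<Phi>" "\<And>x. \<Phi> (0, x) = x" "\<And>t. \<Phi> (t, a) = a"
    "\<And>t x. \<rho> \<le> dist a x \<Longrightarrow> \<Phi> (t, x) = x"
    "\<And>t. \<bar>t\<bar> < t0 \<Longrightarrow> \<exists>\<psi>. Cr_on \<infinity> UNIV \<psi> \<and> (\<forall>x. \<psi> (\<Phi> (t, x)) = x) \<and> (\<forall>x. \<Phi> (t, \<psi> x) = x)"
    "\<And>t. 0 < t \<Longrightarrow> t < t0 \<Longrightarrow> \<exists>s. 0 \<le> s \<and> s < 1 \<and> ((\<lambda>x. \<Phi> (t, x)) has_derivative (\<lambda>v. s *\<^sub>R v)) (at a)"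
    by (rule contraction_family[OF \<rho>(1), of a]) (rule that; assumption)
  let ?I = "{- t0 <..< t0}"
  have \<Phi>r: "Cr_on r UNIV \<Phi>" using Cr_on_mono[OF \<Phi>(1)] by simp
  have inj: "inj (\<lambda>x. \<Phi> (t, x))" if "t \<in> ?I" for t
  proof -
    have "\<bar>t\<bar> < t0" using that by auto
    from \<Phi>(5)[OF this] obtain \<psi> where "\<And>x. \<psi> (\<Phi> (t, x)) = x" by blast
    then show ?thesis by (rule inj_on_inverseI)
  qed
  have supp: "\<Phi> (t, x) = x" if "\<rho> < dist a x" for t x using \<Phi>(4) that by simp
  have slice: "Cr_on r UNIV (\<lambda>x. \<Phi> (t, x))" for t using Cr_on_slice[OF \<Phi>r open_UNIV, of t] by simp
  interpret chart_family X A r c a \<rho> \<Phi> ?I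
  proof unfold_locales
    fix t x assume "t \<in> ?I" "x \<in> snd c ` fst c"
    then show "\<Phi> (t, x) \<in> snd c ` fst c"
      using lift_chart_Cr_map(1)[OF c(1) K slice inj supp] by blast
  qed (use c K \<Phi>r supp in auto)
  have "\<forall>\<^sub>F t in nhds 0. f \<circ> lift t \<in> W"
  proof (rule eventually_perturbation[OF _ \<Phi>(2) _ f W])
    fix t assume "t \<in> ?I"
    then have "\<bar>t\<bar> < t0" by auto
    from \<Phi>(5)[OF this] show "\<exists>\<psi>. Cr_on r UNIV \<psi> \<and> (\<forall>x. \<psi> (\<Phi> (t, x)) = x) \<and> (\<forall>x. \<Phi> (t, \<psi> x) = x)"
      using Cr_on_mono[of \<infinity> UNIV _ r UNIV] by auto
  qed (use t0 in auto)
  then obtain e where e: "0 < e" "\<And>t. dist t 0 < e \<Longrightarrow> f \<circ> lift t \<in> W" unfolding eventually_nhds_metric by blast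
  define t where "t = min e t0 / 2"
  have t: "0 < t" "t < t0" "t < e" "t \<in> ?I" using e t0 by (auto simp: t_def)
  define g where "g = f \<circ> lift t"
  have gW: "g \<in> W" using e(2)[of t] t by (simp add: g_def)
  then have gD: "g \<in> Diff r X A" using openin_subset[OF W(1)] by (auto simp: topspace_Cr_topology)
  have supp_U': "chart_inv c ` cball a \<rho> \<subseteq> U'"
    using \<rho>(3) chart_inv_left[OF c(1)] by fastforce
  have lift_fix: "lift t y = y" if "y \<notin> U'" for y
    using lift_outside[of y t] supp_U' that by blast
  \<comment> \<open>As in the chart, injectivity forces the support ball into itself: a point sent
    outside would be fixed.\<close>
  have lift_U': "lift t y \<in> U'" if y: "y \<in> U'" for y
  proof (cases "y \<in> chart_inv c ` cball a \<rho>")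
    case True
    then obtain z where z: "z \<in> cball a \<rho>" "y = chart_inv c z" by blast
    have zc: "z \<in> snd c ` fst c" using z(1) K by blast
    have "\<Phi> (t, z) \<in> cball a \<rho>"
    proof (rule ccontr)
      assume n: "\<Phi> (t, z) \<notin> cball a \<rho>"
      then have "\<Phi> (t, \<Phi> (t, z)) = \<Phi> (t, z)" by (intro supp) simp
      then have "\<Phi> (t, z) = z" using injD[OF inj[OF t(4)]] by blast
      then show False using n z(1) by simp
    qed
    moreover have "lift t y = chart_inv c (\<Phi> (t, z))"
      using chart_inv_mem[OF c(1) zc] chart_inv_right[OF c(1) zc] by (simp add: z(2) lift_in)
    ultimately show ?thesis using supp_U' by auto
  qed (use y lift_outside in simp)
  have g_eq: "g y = f (lift t y)" for y by (simp add: g_def)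
  \<comment> \<open>Only the first application meets the perturbation: at times strictly between
    \<open>0\<close> and \<open>p\<close> the orbit is outside \<open>U'\<close>, where
    \<open>lift t\<close> is the identity.\<close>
  have g_pow: "(g ^^ j) y = (f ^^ j) (lift t y)" if "y \<in> U'" "0 < j" "j \<le> p" for j y
    using that(2,3)
  proof (induction j)
    case (Suc j)
    show ?case
    proof (cases "j = 0")
      case False
      then have "(g ^^ j) y = (f ^^ j) (lift t y)" using Suc by simp
      moreover have "(f ^^ j) (lift t y) \<notin> U'" using disj[of j "lift t y"] False Suc.prems lift_U'[OF that(1)] by simp
      ultimately show ?thesis using g_eq[of "(g ^^ j) y"] by (simp add: lift_fix)
    qed (use g_eq[of y] in simp)
  qed simp
  have gp: "(g ^^ p) y = lift t y" if "y \<in> U'" for y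
    using g_pow[OF that p(1) order_refl] fp[OF lift_U'[OF that]] by simp
  \<comment> \<open>Passing from \<open>p\<close> to its multiple \<open>N\<close> lets points from
    different steps be counted under one period.\<close>
  obtain k where k: "N = p * k" "0 < k" using p(2) N(1) by (auto simp: dvd_def)
  define B where "B = {x \<in> fst c. snd c x \<in> ball a \<rho>}"
  define U1 where "U1 = {x \<in> fst c. snd c x \<in> ball a R - cball a \<rho>}"
  have in_U': "x \<in> U'" if "x \<in> fst c" "snd c x \<in> cball a R" for x
    using that R(2) inj_onD[OF chart_inj[OF c(1)], of x] by blast
  have BU': "B \<subseteq> U'" and U1U': "U1 \<subseteq> U'" using in_U' \<rho>(2) by (auto simp: B_def U1_def)
  have U1_open: "openin X U1" unfolding U1_def by (rule open_chart_preimage[OF c(1)]) auto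
  have "U1 \<noteq> {}"
  proof -
    \<comment> \<open>Positive dimension supplies a direction, and \<open>3/4 * R\<close> lies
      strictly between the radii \<open>R / 2\<close> and \<open>R\<close> of the shell.\<close>
    obtain b :: 'e where b: "b \<in> Basis" using nonempty_Basis by blast
    define z where "z = a + (3/4 * R) *\<^sub>R b"
    have "dist a z = 3/4 * R" using b R(1) by (simp add: z_def dist_norm)
    then have z: "z \<in> ball a R - cball a \<rho>" "z \<in> cball a R" using R(1) by (auto simp: \<rho>_def)
    then obtain x where "x \<in> fst c" "z = snd c x" using R(2) by blast
    then show ?thesis using z by (auto simp: U1_def)
  qed
  have gN: "(g ^^ N) x = x" if x: "x \<in> U1" for x
  proof -
    have xc: "x \<in> fst c" "\<rho> < dist a (snd c x)" using x by (auto simp: U1_def)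
    then have "lift t x = x" by (simp add: lift_in supp chart_inv_left[OF c(1)])
    then have "(g ^^ p) x = x" using gp[of x] x U1U' by auto
    then have "((g ^^ p) ^^ k) x = x" by (induction k) auto
    then show ?thesis by (simp add: k funpow_mult)
  qed
  obtain s where s: "0 \<le> s" "s < 1" "((\<lambda>x. \<Phi> (t, x)) has_derivative (\<lambda>v. s *\<^sub>R v)) (at a)"
    using \<Phi>(6)[OF t(1,2)] by blast
  have der: "(in_charts c c (g ^^ p) has_derivative (\<lambda>v. s *\<^sub>R v)) (at (snd c q))"
    unfolding a_def[symmetric]
  proof (rule has_derivative_transform_within_open[OF s(3) open_ball[of a \<rho>]])
    fix z assume z: "z \<in> ball a \<rho>"
    then have zK: "z \<in> cball a \<rho>" "z \<in> snd c ` fst c" using K by auto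
    then have "(g ^^ p) (chart_inv c z) = lift t (chart_inv c z)" using supp_U' by (intro gp) auto
    also have "\<dots> = chart_inv c (\<Phi> (t, z))"
      using chart_inv_mem[OF c(1) zK(2)] chart_inv_right[OF c(1) zK(2)] by (simp add: lift_in)
    finally show "\<Phi> (t, z) = in_charts c c (g ^^ p) z"
      using chart_inv_right[OF c(1) \<Phi>_into[OF t(4) zK(2)]] by (simp add: in_charts_apply)
  qed (use \<rho> in auto)
  have "lift t q = q" using c(2) by (simp add: lift_in a_def[symmetric] \<Phi>(3)) (simp add: a_def chart_inv_left[OF c(1)])
  then have gq: "(g ^^ p) q = q" using gp[OF q] by simp
  have B: "openin X B" "q \<in> B" using open_chart_preimage[OF c(1) open_ball] c(2) \<rho>(1) by (auto simp: B_def a_def)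
  obtain V where V: "openin (Cr_topology r X A) V" "g \<in> V" "\<And>h m. h \<in> V \<Longrightarrow> 0 < m \<Longrightarrow> Per0 X (p * m) h \<inter> B \<noteq> {}"
    by (rule persistent_periodic_point[OF gD r p(1) c gq der s(1,2) B]) (rule that; assumption)
  show thesis
  proof (rule that[OF gW U1_open \<open>U1 \<noteq> {}\<close> _ _ _ gN V(1,2)])
    show "B \<inter> U1 = {}" by (auto simp: B_def U1_def)
    show "Per0 X (N * m) h \<inter> B \<noteq> {}" if "h \<in> V" "0 < m" for h m
      using V(3)[of h "k * m"] that k by (simp add: mult.assoc)
  qed (use BU' U1U' U'(3) in auto)
qed

text \<open>\<open>U1\<close> is carried along as a reserve: the points found so far lie outside it
  and the next one is created inside it, so they are distinct. Each step perturbs within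
  \<open>W \<inter> V\<close>, which preserves the earlier points.\<close>

lemma create_periodic_points:
  assumes r: "1 \<le> r" and U: "openin X U" "U \<noteq> {}"
    and N: "1 \<le> N" "\<And>x. x \<in> U \<Longrightarrow> (f ^^ N) x = x" and W: "openin (Cr_topology r X A) W" "f \<in> W"
  shows "\<exists>g\<in>W. \<exists>V U1. openin (Cr_topology r X A) V \<and> g \<in> V \<and> openin X U1 \<and> U1 \<noteq> {} \<and>
    (\<forall>x\<in>U1. (g ^^ N) x = x) \<and>
    (\<forall>h\<in>V. \<forall>m>0. \<exists>T \<subseteq> Per0 X (N * m) h. finite T \<and> card T = k \<and> T \<inter> U1 = {})"
proof (induction k)
  case 0
  show ?case
    by (intro bexI[OF _ W(2)] exI[of _ W] exI[of _ U]) (use U N(2) W in \<open>auto intro!: exI[of _ "{}"]\<close>)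
next
  case (Suc k)
  then obtain g V U1 where g: "g \<in> W" "openin (Cr_topology r X A) V" "g \<in> V" "openin X U1" "U1 \<noteq> {}"
    "\<forall>x\<in>U1. (g ^^ N) x = x"
    and T: "\<forall>h\<in>V. \<forall>m>0. \<exists>T \<subseteq> Per0 X (N * m) h. finite T \<and> card T = k \<and> T \<inter> U1 = {}"
    by (elim bexE exE conjE) (rule that; assumption)
  have gD: "g \<in> Diff r X A" using openin_subset[OF W(1)] g(1) by (auto simp: topspace_Cr_topology)
  have WV: "openin (Cr_topology r X A) (W \<inter> V)" "g \<in> W \<inter> V" using W g by auto
  obtain g' V' B U2 where g': "g' \<in> W \<inter> V" "openin X U2" "U2 \<noteq> {}" "U2 \<subseteq> U1" "B \<subseteq> U1" "B \<inter> U2 = {}"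
    "\<And>x. x \<in> U2 \<Longrightarrow> (g' ^^ N) x = x" "openin (Cr_topology r X A) V'" "g' \<in> V'"
    and z: "\<And>h m. h \<in> V' \<Longrightarrow> 0 < m \<Longrightarrow> Per0 X (N * m) h \<inter> B \<noteq> {}"
    by (rule create_periodic_point[OF gD r g(4,5) N(1) g(6)[rule_format] WV]) (assumption | rule that; assumption)+
  have TS: "\<exists>T \<subseteq> Per0 X (N * m) h. finite T \<and> card T = Suc k \<and> T \<inter> U2 = {}" if h: "h \<in> V \<inter> V'" "0 < m" for h m
  proof -
    obtain T where T': "T \<subseteq> Per0 X (N * m) h" "finite T" "card T = k" "T \<inter> U1 = {}"
      using T[rule_format, of h m] h by auto
    obtain z where z': "z \<in> Per0 X (N * m) h" "z \<in> B" using z[of h m] h by blast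
    have "z \<notin> T" using z' T' g' by blast
    then show ?thesis using T' z' g'(4-6) by (intro exI[of _ "insert z T"]) auto
  qed
  show ?case
    by (rule bexI[of _ g'], rule exI[of _ "V \<inter> V'"], rule exI[of _ U2], intro conjI ballI allI impI TS)
      (use g' g(2) in auto)
qed

end

section \<open>From many isolated points to an infinite upper limit\<close>

lemma ecard_ge: "T \<subseteq> S \<Longrightarrow> finite T \<Longrightarrow> ereal (real (card T)) \<le> ecard S"
  by (auto simp: ecard_def card_mono)

text \<open>The index \<open>i\<close> bounds both the period and the quotient from below. Taking it
  as \<open>max n k\<close> shows that the tail from \<open>n\<close> on has a quotient of at least
  \<open>k\<close>.\<close>

lemma fast_growthI:
  assumes "\<And>n. 1 \<le> n \<Longrightarrow> 0 < a n"
    and "\<And>i. \<exists>n\<ge>Suc i. ereal (real (Suc i * a n)) \<le> ecard (Per0 X n f)"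
  shows "fast_growth X a f"
proof -
  have "(SUP m\<in>{n..}. ecard (Per0 X m f) / ereal (real (a m))) = \<infinity>" for n
  proof (rule SUP_PInfty)
    fix k
    obtain m where m: "Suc (max n k) \<le> m" "ereal (real (Suc (max n k) * a m)) \<le> ecard (Per0 X m f)"
      using assms(2) by blast
    have am: "0 < a m" using m(1) by (intro assms(1)) simp
    have "ereal (real k) \<le> ecard (Per0 X m f) / ereal (real (a m))"
    proof (cases "ecard (Per0 X m f)")
      case (real e)
      have "real k * real (a m) \<le> real (Suc (max n k) * a m)"
        unfolding of_nat_mult by (intro mult_right_mono) auto
      also have "\<dots> \<le> e" using m(2) real by simp
      finally show ?thesis using am real by (simp add: pos_le_divide_eq)
    qed (use m am in \<open>auto simp: divide_ereal_def\<close>)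
    then show "\<exists>i\<in>{n..}. ereal (real k) \<le> ecard (Per0 X i f) / ereal (real (a i))"
      using m(1) by (intro bexI[of _ m]) auto
  qed
  then show ?thesis by (simp add: fast_growth_def limsup_INF_SUP)
qed

theorem proposition2p2:
  fixes X :: "'m topology" and A :: "('m, 'e::euclidean_space) chart set"
    and r :: enat and a :: "nat \<Rightarrow> nat"
  assumes "smooth_manifold X A"
    and "compact_space X"
    and "1 \<le> r"
    and "\<And>n. 1 \<le> n \<Longrightarrow> 0 < a n"
  shows "generically_localizable r X A (fast_growth X a)"
proof -
  interpret smooth_mfd X A by unfold_locales (fact assms)
  \<comment> \<open>Each \<open>Q i\<close> must be localizable for every \<open>N\<close>, so its
    period is existential; the witness is \<open>N * Suc i\<close>, a multiple of \<open>N\<close>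
    that is at least \<open>Suc i\<close>. Using \<open>Suc i\<close> excludes the period
    \<open>0\<close>, where \<open>a\<close> need not be positive.\<close>
  define Q where "Q i g \<longleftrightarrow> (\<exists>n\<ge>Suc i. ereal (real (Suc i * a n)) \<le> ecard (Per0 X n g))" for i g
  have "openly_localizable r X A (Q i)" for i
    unfolding openly_localizable_def has_perturbation_def
  proof (intro allI impI)
    fix U N f W
    assume U: "openin X U \<and> U \<noteq> {} \<and> 1 \<le> N \<and> f \<in> Diff r X A \<and> (\<forall>x\<in>U. (f ^^ N) x = x)"
      and W: "openin (Cr_topology r X A) W \<and> f \<in> W"
    have N: "1 \<le> N" using U by blast
    have "\<exists>g\<in>W. \<exists>V U1. openin (Cr_topology r X A) V \<and> g \<in> V \<and> openin X U1 \<and> U1 \<noteq> {} \<and>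
        (\<forall>x\<in>U1. (g ^^ N) x = x) \<and>
        (\<forall>h\<in>V. \<forall>m>0. \<exists>T \<subseteq> Per0 X (N * m) h. finite T \<and> card T = Suc i * a (N * Suc i) \<and> T \<inter> U1 = {})"
      by (rule create_periodic_points[OF assms(3), of U N f W]) (use U W in auto)
    then obtain g V U1 where g: "g \<in> W" "openin (Cr_topology r X A) V" "g \<in> V"
      and T: "\<forall>h\<in>V. \<forall>m>0. \<exists>T \<subseteq> Per0 X (N * m) h. finite T \<and> card T = Suc i * a (N * Suc i) \<and> T \<inter> U1 = {}"
      by (elim bexE exE conjE) (rule that; assumption)
    have "Q i h" if h: "h \<in> V" for h
    proof -
      obtain T where "T \<subseteq> Per0 X (N * Suc i) h" "finite T" "card T = Suc i * a (N * Suc i)"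
        using T[rule_format, OF h zero_less_Suc[of i]] by blast
      then have "ereal (real (Suc i * a (N * Suc i))) \<le> ecard (Per0 X (N * Suc i) h)"
        using ecard_ge by fastforce
      moreover have "Suc i \<le> N * Suc i" using mult_le_mono1[OF N, of "Suc i"] by simp
      ultimately show ?thesis unfolding Q_def by blast
    qed
    with g show "\<exists>g\<in>W. \<exists>V. openin (Cr_topology r X A) V \<and> g \<in> V \<and> (\<forall>h\<in>V. Q i h)" by blast
  qed
  moreover have "fast_growth X a f" if "\<forall>i. Q i f" for f
    by (rule fast_growthI) (use assms(4) that in \<open>auto simp: Q_def\<close>)
  ultimately show ?thesis unfolding generically_localizable_def by blast
qed

end
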